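(* Let $N\ge 2$, $s\in(0,1)$, let $\Omega\subset\mathbb{R}^N$ be a bounded $C^2$ domain containing the origin, and let $\mu>\mu_0$. Let $Q\in C^\beta_{loc}(\mathbb{R}^N\setminus\{0\})$ for some $\beta\in(0,1)$ be a positive function such that, for some $\theta\in\mathbb{R}$, $$\liminf_{|x|\to+\infty}Q(x)|x|^{-\theta}>0\quad\text{and}\quad\limsup_{|x|\to+\infty}Q(x)|x|^{-\theta}<+\infty .$$ Set $p^*_{\mu,\theta}=1+\frac{2s+\theta}{-\tau_-}$. If $\tau_--2s<\theta<-2s$ and $p=p^*_{\mu,\theta}\in(0,1)$, then the problem $$\mathcal{L}_\mu^s u\ge Q u^p\ \text{ in }\mathbb{R}^N\setminus\overline\Omega,\qquad u\ge0\ \text{ in }\overline\Omega$$ has infinitely many positive classical solutions.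
   Context: $\mu_0=-2^{2s}\frac{\Gamma^2(\frac{N+2s}{4})}{\Gamma^2(\frac{N-2s}{4})}$. The fractional Laplacian is $(-\Delta)^s u(x)=\lim_{\varepsilon\to0^+}C_{N,s}\int_{\mathbb{R}^N\setminus B_\varepsilon(x)}\frac{u(x)-u(z)}{|x-z|^{N+2s}}dz$, $C_{N,s}=2^{2s}\pi^{-N/2}s\frac{\Gamma(\frac{N+2s}{2})}{\Gamma(1-s)}$, where $B_\varepsilon(x)$ is the ball of radius $\varepsilon$ centred at $x$, and $\mathcal{L}^s_\mu=(-\Delta)^s+\frac{\mu}{|x|^{2s}}$. For $\tau\in(-N,2s)$ let $c_s(\tau)=2^{2s}\frac{\Gamma(\frac{N+\tau}{2})\Gamma(\frac{2s-\tau}{2})}{\Gamma(-\frac{\tau}{2})\Gamma(\frac{N-2s+\tau}{2})}$ (with $1/\Gamma=0$ at poles of $\Gamma$); $c_s$ is strictly concave with maximum $-\mu_0$ attained at $\frac{2s-N}{2}$. For $\mu>\mu_0$, $\tau_-=\tau_-(s,\mu)<\tau_+=\tau_+(s,\mu)$ are the two zeros in $(-N,2s)$ of $c_s(\tau)+\mu$; $\tau_-+\tau_+=2s-N$ and $\tau_-<0$. $L^1_s(\mathbb{R}^N)=\{w\in L^1_{loc}(\mathbb{R}^N):\int_{\mathbb{R}^N}\frac{|w(x)|}{1+|x|^{N+2s}}dx<\infty\}$. A classical solution is a function $u\in L^1_s(\mathbb{R}^N)\cap C(\mathbb{R}^N\setminus\overline\Omega)$ satisfying the inequality pointwise in $\mathbb{R}^N\setminus\overline\Omega$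 and $u\ge0$ in $\overline\Omega$; it is positive if $u>0$ a.e. in $\mathbb{R}^N\setminus\overline\Omega$. *)

theory Defs
  imports "HOL-Analysis.Analysis"
begin

definition C2_function :: "('a::euclidean_space \<Rightarrow> real) \<Rightarrow> bool" where
  "C2_function f \<longleftrightarrow>
     (\<exists>(f' :: 'a \<Rightarrow> 'a \<Rightarrow>\<^sub>L real) (f'' :: 'a \<Rightarrow> 'a \<Rightarrow>\<^sub>L ('a \<Rightarrow>\<^sub>L real)).
        (\<forall>x. (f has_derivative blinfun_apply (f' x)) (at x)) \<and>
        (\<forall>x. (f' has_derivative blinfun_apply (f'' x)) (at x)) \<and>
        continuous_on UNIV f'')"

text \<open>
  Near each boundary point the set is the strict epigraph of a \<open>C\<^sup>2\<close> function over a hyperplane.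
  The unit vector \<open>e\<close> plays the role of the last axis after a rotation of coordinates;
  \<open>y - (y \<bullet> e) *\<^sub>R e\<close> is the projection of \<open>y\<close> to the hyperplane orthogonal to \<open>e\<close>,
  so only the values of \<open>\<gamma>\<close> on that hyperplane matter.
\<close>

definition C2_boundary :: "'a::euclidean_space set \<Rightarrow> bool" where
  "C2_boundary \<Omega> \<longleftrightarrow>
     (\<forall>x \<in> frontier \<Omega>. \<exists>r > 0. \<exists>e. \<exists>\<gamma>. norm e = 1 \<and> C2_function \<gamma> \<and>
        \<Omega> \<inter> ball x r = {y \<in> ball x r. \<gamma> (y - (y \<bullet> e) *\<^sub>R e) < y \<bullet> e})"

definition bounded_C2_domain :: "'a::euclidean_space set \<Rightarrow> bool" where
  "bounded_C2_domain \<Omega> \<longleftrightarrow>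
     open \<Omega> \<and> connected \<Omega> \<and> \<Omega> \<noteq> {} \<and> bounded \<Omega> \<and> C2_boundary \<Omega>"

definition locally_Holder_on :: "real \<Rightarrow> 'a::euclidean_space set \<Rightarrow> ('a \<Rightarrow> real) \<Rightarrow> bool" where
  "locally_Holder_on \<beta> U f \<longleftrightarrow>
     (\<forall>K. compact K \<and> K \<subseteq> U \<longrightarrow>
        (\<exists>C. \<forall>x\<in>K. \<forall>y\<in>K. \<bar>f x - f y\<bar> \<le> C * dist x y powr \<beta>))"

definition mu0 :: "nat \<Rightarrow> real \<Rightarrow> real" where
  "mu0 N s = - (2 powr (2 * s)) * (Gamma ((real N + 2 * s) / 4))\<^sup>2 / (Gamma ((real N - 2 * s) / 4))\<^sup>2"

definition c_s :: "nat \<Rightarrow> real \<Rightarrow> real \<Rightarrow> real" where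
  "c_s N s \<tau> = 2 powr (2 * s) * (Gamma ((real N + \<tau>) / 2) * Gamma ((2 * s - \<tau>) / 2))
                 * (rGamma (- \<tau> / 2) * rGamma ((real N - 2 * s + \<tau>) / 2))"

text \<open>
  For \<open>\<mu> > mu0 N s\<close> the function \<open>\<lambda>\<tau>. c_s N s \<tau> + \<mu>\<close> has exactly two zeros in the
  open interval from \<open>- N\<close> to \<open>2 * s\<close>; this is the smaller one.
\<close>

definition tau_minus :: "nat \<Rightarrow> real \<Rightarrow> real \<Rightarrow> real" where
  "tau_minus N s \<mu> = (LEAST \<tau>. - real N < \<tau> \<and> \<tau> < 2 * s \<and> c_s N s \<tau> + \<mu> = 0)"

definition p_star :: "nat \<Rightarrow> real \<Rightarrow> real \<Rightarrow> real \<Rightarrow> real" where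
  "p_star N s \<mu> \<theta> = 1 + (2 * s + \<theta>) / (- tau_minus N s \<mu>)"

definition L1s :: "real \<Rightarrow> ('a::euclidean_space \<Rightarrow> real) set" where
  "L1s s = {w. (\<forall>K. compact K \<longrightarrow> set_integrable lebesgue K w) \<and>
               integrable lebesgue (\<lambda>x. \<bar>w x\<bar> / (1 + norm x powr (real DIM('a) + 2 * s)))}"

definition C_Ns :: "nat \<Rightarrow> real \<Rightarrow> real" where
  "C_Ns N s = 2 powr (2 * s) * pi powr (- real N / 2) * s
                * (Gamma ((real N + 2 * s) / 2) / Gamma (1 - s))"

definition truncated_frac_laplacian ::
    "real \<Rightarrow> ('a::euclidean_space \<Rightarrow> real) \<Rightarrow> 'a \<Rightarrow> real \<Rightarrow> real" where
  "truncated_frac_laplacian s u x \<epsilon> =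
     C_Ns DIM('a) s *
       (LINT z : - ball x \<epsilon> | lebesgue. (u x - u z) / norm (x - z) powr (real DIM('a) + 2 * s))"

definition frac_laplacian_exists :: "real \<Rightarrow> ('a::euclidean_space \<Rightarrow> real) \<Rightarrow> 'a \<Rightarrow> bool" where
  "frac_laplacian_exists s u x \<longleftrightarrow>
     (\<exists>l. (truncated_frac_laplacian s u x \<longlongrightarrow> l) (at_right 0))"

definition frac_laplacian :: "real \<Rightarrow> ('a::euclidean_space \<Rightarrow> real) \<Rightarrow> 'a \<Rightarrow> real" where
  "frac_laplacian s u x = Lim (at_right 0) (truncated_frac_laplacian s u x)"

definition hardy_op :: "real \<Rightarrow> real \<Rightarrow> ('a::euclidean_space \<Rightarrow> real) \<Rightarrow> 'a \<Rightarrow> real" where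
  "hardy_op s \<mu> u x = frac_laplacian s u x + \<mu> / norm x powr (2 * s) * u x"

text \<open>
  Since \<open>Lim\<close> is total, convergence of the principal value is required explicitly.
  For \<open>u \<in> L1s s\<close> all truncated integrals converge absolutely.
\<close>

definition classical_solution ::
    "real \<Rightarrow> real \<Rightarrow> 'a::euclidean_space set \<Rightarrow> ('a \<Rightarrow> real) \<Rightarrow> real \<Rightarrow> ('a \<Rightarrow> real) \<Rightarrow> bool" where
  "classical_solution s \<mu> \<Omega> Q p u \<longleftrightarrow>
     u \<in> L1s s \<and> continuous_on (- closure \<Omega>) u \<and>
     (\<forall>x \<in> - closure \<Omega>. frac_laplacian_exists s u x \<and> hardy_op s \<mu> u x \<ge> Q x * u x powr p) \<and>
     (\<forall>x \<in> closure \<Omega>. u x \<ge> 0)"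

definition positive_classical_solution ::
    "real \<Rightarrow> real \<Rightarrow> 'a::euclidean_space set \<Rightarrow> ('a \<Rightarrow> real) \<Rightarrow> real \<Rightarrow> ('a \<Rightarrow> real) \<Rightarrow> bool" where
  "positive_classical_solution s \<mu> \<Omega> Q p u \<longleftrightarrow>
     classical_solution s \<mu> \<Omega> Q p u \<and> (AE x in lebesgue. x \<in> - closure \<Omega> \<longrightarrow> u x > 0)"

text \<open>
  Solutions are elements of an \<open>L\<^sup>1\<close> space. They are counted modulo equality almost everywhere, so
  that changing a single solution on null sets does not produce new ones.
\<close>

definition ae_eq :: "(('a::euclidean_space \<Rightarrow> real) \<times> ('a \<Rightarrow> real)) set" where
  "ae_eq = {(u, v). AE x in lebesgue. u x = v x}"

end

theory Submission
  imports Defs "HOL-Probability.Distributions"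
begin

text \<open>
  For the midpoint exponent \<open>- a = (2 * s - N) / 2\<close>, where \<open>c_s\<close> takes the value \<open>- mu0\<close>, the function
  \<open>u x = t * norm x powr (- a)\<close> satisfies
  \<open>hardy_op s \<mu> u x = t * (\<mu> - mu0) * norm x powr (- a - 2 * s)\<close> with a positive constant. Because
  \<open>tau_minus < - a\<close>, the right-hand side \<open>Q * u powr p\<close> decays at least as fast as
  \<open>norm x powr (- a - 2 * s)\<close>, and because \<open>p < 1\<close> it is dominated once \<open>t\<close> is large. The exterior domain
  stays away from the origin, so every large \<open>t\<close> yields a solution.

  The fractional Laplacian of \<open>norm x powr (- a)\<close> is computed by writing both the kernel and the power as
  superpositions of Gaussians. After symmetrisation in \<open>y\<close> all integrals converge absolutely, and two
  applications of Fubini's theorem reduce the constant to a regularised Beta integral.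
\<close>

section \<open>Gaussian and Gamma integrals\<close>

text \<open>For \<open>p = p_star\<close> the power with exponent \<open>tau_minus\<close> balances
  both sides exactly: \<open>\<theta> + tau_minus * p = tau_minus - 2 * s\<close>. It cannot serve
  as a solution, since \<open>c_s + \<mu>\<close> vanishes there and the left-hand side is zero.
  Passing to the larger exponent \<open>- a\<close> shifts the balance by
  \<open>(1 - p) * (tau_minus + a)\<close>, which has the favourable sign because
  \<open>p < 1\<close>. The midpoint is the exponent where \<open>c_s\<close> has a closed form that
  the hypothesis \<open>\<mu> > mu0\<close> directly compares with \<open>\<mu>\<close>. The
  obstacle in computing \<open>c_s\<close> is that the kernel is not integrable at 0, so the two
  terms of the difference cannot be integrated separately against it. For one Gaussian of width
  \<open>T\<close> both are finite, and their difference acquires a factor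
  \<open>beta_defect b (m * T)\<close>. This factor is of first order in \<open>m * T\<close> near 0
  and equals 1 beyond 1, so it can be integrated against \<open>T powr (- s - 1)\<close> for
  \<open>0 < s < 1\<close>.\<close>

lemma nn_integral_gaussian_real:
  fixes l :: real
  assumes "l > 0"
  shows "(\<integral>\<^sup>+x. ennreal (exp (- l * x\<^sup>2)) \<partial>lborel) = ennreal (sqrt (pi / l))"
proof -
  define \<sigma> where "\<sigma> = 1 / sqrt (2 * l)"
  have \<sigma>: "\<sigma> > 0" "2 * \<sigma>\<^sup>2 = 1 / l"
    using assms by (auto simp: \<sigma>_def power_divide)
  interpret N: prob_space "density lborel (normal_density 0 \<sigma>)"
    by (rule prob_space_normal_density) fact
  have "exp (- l * x\<^sup>2) = sqrt (pi / l) * normal_density 0 \<sigma> x" for x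
  proof -
    have "2 * pi * \<sigma>\<^sup>2 = pi / l" using \<sigma>(2) by (simp add: field_simps)
    moreover have "x\<^sup>2 / (2 * \<sigma>\<^sup>2) = l * x\<^sup>2" unfolding \<sigma>(2) by simp
    ultimately show ?thesis using assms by (simp add: normal_density_def)
  qed
  then have "(\<integral>\<^sup>+x. ennreal (exp (- l * x\<^sup>2)) \<partial>lborel)
      = (\<integral>\<^sup>+x. ennreal (sqrt (pi / l)) * ennreal (normal_density 0 \<sigma> x) \<partial>lborel)"
    using assms by (simp add: ennreal_mult)
  also have "\<dots> = ennreal (sqrt (pi / l)) * emeasure (density lborel (normal_density 0 \<sigma>)) (space lborel)"
    by (simp add: nn_integral_cmult emeasure_density)
  also have "\<dots> = ennreal (sqrt (pi / l))"
    using N.emeasure_space_1 by simp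
  finally show ?thesis .
qed

text \<open>The squared norm is a sum over the basis, so the integral factorises into
  one-dimensional ones.\<close>

lemma nn_integral_gaussian:
  fixes l :: real
  assumes "l > 0"
  shows "(\<integral>\<^sup>+y. ennreal (exp (- l * (norm y)\<^sup>2)) \<partial>(lborel :: 'a::euclidean_space measure))
    = ennreal ((pi / l) powr (real DIM('a) / 2))"
proof -
  have "ennreal (exp (- l * (norm y)\<^sup>2)) = (\<Prod>b\<in>Basis. ennreal (exp (- l * (y \<bullet> b)\<^sup>2)))" for y :: 'a
  proof -
    have "(norm y)\<^sup>2 = (\<Sum>b\<in>Basis. (y \<bullet> b)\<^sup>2)"
      by (simp add: norm_eq_sqrt_inner euclidean_inner[of y y] power2_eq_square sum_nonneg)
    then show ?thesis by (simp add: sum_distrib_left exp_sum prod_ennreal flip: sum_negf)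
  qed
  then have "(\<integral>\<^sup>+y. ennreal (exp (- l * (norm y)\<^sup>2)) \<partial>(lborel :: 'a measure))
      = (\<Prod>b\<in>(Basis :: 'a set). \<integral>\<^sup>+x. ennreal (exp (- l * x\<^sup>2)) \<partial>lborel)"
    using nn_integral_lborel_prod[where ?'a = 'a, of "\<lambda>_ x. ennreal (exp (- l * x\<^sup>2))"] by simp
  also have "\<dots> = ennreal (sqrt (pi / l) ^ DIM('a))"
    unfolding nn_integral_gaussian_real[OF assms] using assms by (simp add: ennreal_power)
  also have "sqrt (pi / l) ^ DIM('a) = (pi / l) powr (real DIM('a) / 2)"
    using assms by (simp add: powr_half_sqrt[symmetric] powr_powr flip: powr_realpow)
  finally show ?thesis .
qed

lemma nn_integral_lborel_translation:
  fixes f :: "'a::euclidean_space \<Rightarrow> ennreal"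
  assumes [measurable]: "f \<in> borel_measurable borel"
  shows "(\<integral>\<^sup>+y. f (c + y) \<partial>lborel) = (\<integral>\<^sup>+y. f y \<partial>lborel)"
proof -
  have "(\<integral>\<^sup>+y. f y \<partial>lborel) = (\<integral>\<^sup>+y. f y \<partial>distr lborel borel ((+) c))"
    by (simp add: lborel_distr_plus)
  then show ?thesis by (simp add: nn_integral_distr)
qed

lemma nn_integral_gaussian_product:
  fixes x :: "'a::euclidean_space" and l t :: real
  assumes "l > 0" "t > 0"
  shows "(\<integral>\<^sup>+y. ennreal (exp (- l * (norm (x + y))\<^sup>2) * exp (- t * (norm y)\<^sup>2)) \<partial>lborel)
    = ennreal ((pi / (l + t)) powr (real DIM('a) / 2) * exp (- (l * t / (l + t)) * (norm x)\<^sup>2))"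
proof -
  \<comment> \<open>Completing the square: \<open>- c\<close> is the minimiser of the total exponent
    in \<open>y\<close>, and the minimum is what \<open>E\<close> records.\<close>
  define c where "c = (l / (l + t)) *\<^sub>R x"
  define E where "E = exp (- (l * t / (l + t)) * (norm x)\<^sup>2)"
  have "exp (- l * (norm (x + y))\<^sup>2) * exp (- t * (norm y)\<^sup>2) = E * exp (- (l + t) * (norm (c + y))\<^sup>2)" for y
  proof -
    have "l * (norm (x + y))\<^sup>2 + t * (norm y)\<^sup>2
        = (l * t / (l + t)) * (norm x)\<^sup>2 + (l + t) * (norm (c + y))\<^sup>2"
      using assms unfolding c_def
      by (simp add: power2_norm_eq_inner inner_add_left inner_add_right inner_commute divide_simps)
         (simp add: algebra_simps power2_eq_square)
    then show ?thesis
      unfolding E_def exp_add[symmetric] by (simp add: algebra_simps)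
  qed
  then have "(\<integral>\<^sup>+y. ennreal (exp (- l * (norm (x + y))\<^sup>2) * exp (- t * (norm y)\<^sup>2)) \<partial>lborel)
      = (\<integral>\<^sup>+y. ennreal E * ennreal (exp (- (l + t) * (norm (c + y))\<^sup>2)) \<partial>lborel)"
    by (simp add: E_def flip: ennreal_mult)
  also have "\<dots> = ennreal E * (\<integral>\<^sup>+y. ennreal (exp (- (l + t) * (norm (c + y))\<^sup>2)) \<partial>lborel)"
    by (simp add: nn_integral_cmult)
  also have "(\<integral>\<^sup>+y. ennreal (exp (- (l + t) * (norm (c + y))\<^sup>2)) \<partial>lborel)
      = (\<integral>\<^sup>+y. ennreal (exp (- (l + t) * (norm (y :: 'a))\<^sup>2)) \<partial>lborel)"
    by (rule nn_integral_lborel_translation) measurable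
  also have "\<dots> = ennreal ((pi / (l + t)) powr (real DIM('a) / 2))"
    using assms by (intro nn_integral_gaussian) auto
  finally show ?thesis
    by (simp add: E_def mult.commute flip: ennreal_mult)
qed

text \<open>With \<open>q\<close> a squared norm this writes a negative power of the norm as a
  superposition of Gaussians with rates \<open>l\<close>.\<close>

lemma nn_integral_powr_exp:
  fixes c q :: real
  assumes "c > 0" "q > 0"
  shows "(\<integral>\<^sup>+l. ennreal (indicator {0<..} l * (l powr (c - 1) * exp (- q * l))) \<partial>lborel)
    = ennreal (Gamma c * q powr (- c))"
proof -
  have *: "indicator {0<..} (0 + (1 / q) * l) * ((0 + (1 / q) * l) powr (c - 1) * exp (- q * (0 + (1 / q) * l)))
      = q powr (1 - c) * (indicator {0..} l * l powr (c - 1) / exp l)" for l :: real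
  proof (cases "l > 0")
    case True
    then have "(l / q) powr (c - 1) = q powr (1 - c) * l powr (c - 1)"
      using assms by (simp add: powr_divide powr_diff)
    then show ?thesis using True assms by (simp add: exp_minus field_simps indicator_def)
  next
    case False
    then have "\<not> 0 < l / q" using assms by (simp add: divide_le_0_iff not_less)
    with False show ?thesis using assms by (auto simp: indicator_def)
  qed
  have "(\<integral>\<^sup>+l. ennreal (indicator {0<..} l * (l powr (c - 1) * exp (- q * l))) \<partial>lborel)
    = ennreal \<bar>1 / q\<bar> * (\<integral>\<^sup>+l. ennreal (q powr (1 - c) * (indicator {0..} l * l powr (c - 1) / exp l)) \<partial>lborel)"
    by (subst nn_integral_real_affine[where c = "1 / q" and t = 0]) (use assms in \<open>simp_all only: *, auto\<close>)
  also have "(\<integral>\<^sup>+l. ennreal (q powr (1 - c) * (indicator {0..} l * l powr (c - 1) / exp l)) \<partial>lborel)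
    = ennreal (q powr (1 - c)) * (\<integral>\<^sup>+l. ennreal (indicator {0..} l * l powr (c - 1) / exp l) \<partial>lborel)"
    by (subst nn_integral_cmult[symmetric])
       (auto simp flip: ennreal_mult' intro!: nn_integral_cong arg_cong[where f = ennreal])
  also have "\<dots> = ennreal (q powr (1 - c)) * ennreal (Gamma c)"
    using assms by (simp add: Gamma_conv_nn_integral_real)
  also have "ennreal \<bar>1 / q\<bar> * \<dots> = ennreal (Gamma c * q powr (- c))"
    using assms by (simp add: powr_diff powr_minus field_simps flip: ennreal_mult)
  finally show ?thesis .
qed

text \<open>Transfers the change of variables for absolutely integrable functions to nonnegative
  integrals, where the value may be infinite.\<close>

lemma nn_integral_change_of_variables_real:
  fixes f g g' :: "real \<Rightarrow> real"
  assumes S[measurable]: "S \<in> sets borel" "g ` S \<in> sets borel"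
    and g: "\<And>x. x \<in> S \<Longrightarrow> (g has_field_derivative g' x) (at x)" "inj_on g S"
    and [measurable]: "f \<in> borel_measurable borel" "g \<in> borel_measurable borel" "g' \<in> borel_measurable borel"
    and nonneg: "\<And>x. f x \<ge> 0"
  shows "(\<integral>\<^sup>+x. ennreal (indicator (g ` S) x * f x) \<partial>lborel)
    = (\<integral>\<^sup>+x. ennreal (indicator S x * (\<bar>g' x\<bar> * f (g x))) \<partial>lborel)"
proof -
  let ?F = "\<lambda>x. indicator (g ` S) x * f x" and ?G = "\<lambda>x. indicator S x * (\<bar>g' x\<bar> * f (g x))"
  have cov: "(\<lambda>x. \<bar>g' x\<bar> * f (g x)) absolutely_integrable_on S \<and> integral S (\<lambda>x. \<bar>g' x\<bar> * f (g x)) = b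
     \<longleftrightarrow> f absolutely_integrable_on (g ` S) \<and> integral (g ` S) f = b" for b
    by (rule has_absolute_integral_change_of_variables_1')
       (use g in \<open>auto intro: has_field_derivative_at_within\<close>)
  have F: "f absolutely_integrable_on (g ` S) \<longleftrightarrow> integrable lborel ?F"
    by (simp add: set_integrable_def integrable_completion)
  have G: "(\<lambda>x. \<bar>g' x\<bar> * f (g x)) absolutely_integrable_on S \<longleftrightarrow> integrable lborel ?G"
    by (simp add: set_integrable_def integrable_completion)
  show ?thesis
  proof (cases "integrable lborel ?F")
    case True
    then have G': "integrable lborel ?G" and eq: "integral S (\<lambda>x. \<bar>g' x\<bar> * f (g x)) = integral (g ` S) f"
      using cov[of "integral (g ` S) f"] F G by auto
    have "integral (g ` S) f = (\<integral>x. ?F x \<partial>lborel)"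
      using set_lebesgue_integral_eq_integral(2)[of "g ` S" f] True F
      by (simp add: set_lebesgue_integral_def integral_completion)
    moreover have "integral S (\<lambda>x. \<bar>g' x\<bar> * f (g x)) = (\<integral>x. ?G x \<partial>lborel)"
      using set_lebesgue_integral_eq_integral(2)[of S "\<lambda>x. \<bar>g' x\<bar> * f (g x)"] G' G
      by (simp add: set_lebesgue_integral_def integral_completion)
    ultimately show ?thesis
      using eq True G' nonneg by (simp add: nn_integral_eq_integral)
  next
    case False
    \<comment> \<open>The substitution preserves integrability in both directions, so here both
      sides are infinite.\<close>
    then have "\<not> integrable lborel ?G" using cov F G by blast
    with False show ?thesis
      using nonneg by (simp add: integrable_iff_bounded less_top[symmetric])
  qed
qed

text \<open>The same superposition, parametrised by the width \<open>T = 1 / l\<close>. It is used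
  for the kernel, so that rates of the power and widths of the kernel meet only in the product
  \<open>m * T\<close>.\<close>

lemma nn_integral_powr_exp_inverse:
  fixes c q :: real
  assumes "c > 0" "q > 0"
  shows "(\<integral>\<^sup>+T. ennreal (indicator {0<..} T * (T powr (- c - 1) * exp (- q / T))) \<partial>lborel)
    = ennreal (Gamma c * q powr (- c))"
proof -
  have im: "(\<lambda>x::real. 1 / x) ` {0<..} = {0<..}"
    by (auto simp: image_iff intro!: bexI[of _ "1 / x" for x])
  have "(\<integral>\<^sup>+l. ennreal (indicator ((\<lambda>x. 1 / x) ` {0<..}) l * (l powr (c - 1) * exp (- q * l))) \<partial>lborel)
    = (\<integral>\<^sup>+T. ennreal (indicator {0<..} T * (\<bar>- 1 / T\<^sup>2\<bar> * ((1 / T) powr (c - 1) * exp (- q * (1 / T))))) \<partial>lborel)"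
    by (rule nn_integral_change_of_variables_real)
       (auto simp: im inj_on_def power2_eq_square intro!: derivative_eq_intros)
  also have "\<dots> = (\<integral>\<^sup>+T. ennreal (indicator {0<..} T * (T powr (- c - 1) * exp (- q / T))) \<partial>lborel)"
  proof (intro nn_integral_cong arg_cong[where f = ennreal])
    fix T :: real
    show "indicator {0<..} T * (\<bar>- 1 / T\<^sup>2\<bar> * ((1 / T) powr (c - 1) * exp (- q * (1 / T))))
      = indicator {0<..} T * (T powr (- c - 1) * exp (- q / T))"
    proof (cases "T > 0")
      case True
      then have "1 / T\<^sup>2 * (1 / T) powr (c - 1) = T powr (- c - 1)"
        by (simp add: powr_divide powr_diff powr_minus field_simps power2_eq_square)
      then have "1 / T\<^sup>2 * (1 / T) powr (c - 1) * exp (- q / T) = T powr (- c - 1) * exp (- q / T)"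
        by (rule arg_cong[where f = "\<lambda>z. z * exp (- q / T)"])
      with True show ?thesis by (simp add: mult.assoc)
    qed auto
  qed
  finally show ?thesis
    using nn_integral_powr_exp[OF assms] by (simp add: im)
qed

text \<open>For a nonnegative Borel function a gauge integral is a Lebesgue integral; this imports
  the known values of Beta and tail integrals.\<close>

lemma has_bochner_integral_nonneg_has_integral:
  fixes f :: "'a::euclidean_space \<Rightarrow> real"
  assumes [measurable]: "f \<in> borel_measurable borel" "S \<in> sets borel"
    and "\<And>x. x \<in> S \<Longrightarrow> 0 \<le> f x" "(f has_integral I) S"
  shows "has_bochner_integral lborel (\<lambda>x. indicator S x * f x) I"
proof (rule has_bochner_integral_nn_integral)
  show "(\<integral>\<^sup>+x. ennreal (indicator S x * f x) \<partial>lborel) = ennreal I"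
    using nn_integral_has_integral_lebesgue[OF assms(3,4)] by simp
  show "0 \<le> I" using has_integral_nonneg[OF assms(4,3)] .
  show "AE x in lborel. 0 \<le> indicator S x * f x"
    using assms(3) by (intro AE_I2) (simp add: indicator_def)
qed measurable

section \<open>A regularised Beta integral\<close>

text \<open>Averaging \<open>norm x powr (- a)\<close> over a normalised Gaussian of width
  \<open>T\<close> multiplies its Laplace density at \<open>m\<close> by the positive part of
  \<open>1 - m * T\<close> to the power \<open>b - 1\<close>, with \<open>b = (N - a) / 2\<close>.
  The defect is 1 minus this multiplier; the \<open>if\<close> encodes the positive part.\<close>

definition beta_defect :: "real \<Rightarrow> real \<Rightarrow> real" where
  "beta_defect b w = 1 - (if w < 1 then (1 - w) powr (b - 1) else 0)"

lemma measurable_beta_defect[measurable]: "beta_defect b \<in> borel_measurable borel"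
  unfolding beta_defect_def[abs_def] by measurable

text \<open>Integration by parts: integrating \<open>w powr (- s - 1)\<close> and differentiating
  the other factor leaves \<open>b / s\<close> times a Beta integrand, and the boundary term at 1 is
  \<open>- 1 / s\<close>.\<close>

lemma has_integral_powr_one_minus_powr:
  fixes s b :: real
  assumes s: "0 < s" "s < 1" and b: "0 < b"
  shows "((\<lambda>w. w powr (- s - 1) * (1 - (1 - w) powr b)) has_integral (b / s * Beta (1 - s) b - 1 / s)) {0..1}"
proof -
  define F where "F = (\<lambda>w::real. - (w powr (- s) * (1 - (1 - w) powr b)) / s)"
  define f where "f = (\<lambda>w::real. w powr (- s - 1) * (1 - (1 - w) powr b))"
  define h where "h = (\<lambda>w::real. w powr ((1 - s) - 1) * (1 - w) powr (b - 1))"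
  have "((\<lambda>w. f w - b / s * h w) has_integral (F 1 - F 0)) {0..1}"
  proof (rule fundamental_theorem_of_calculus_interior)
    show "continuous_on {0..1} F"
    proof -
      have "continuous (at w within {0..1}) F" if w: "w \<in> {0..1}" for w
      proof (cases "w = 0")
        case False
        have A: "((\<lambda>v. v powr (- s)) \<longlongrightarrow> w powr (- s)) (at w within {0..1})"
          using False by (intro tendsto_powr tendsto_intros) auto
        \<comment> \<open>At \<open>w = 1\<close> the base tends to 0, which is harmless because
          \<open>b > 0\<close> and the base stays nonnegative on the interval.\<close>
        have B: "((\<lambda>v. (1 - v) powr b) \<longlongrightarrow> (1 - w) powr b) (at w within {0..1})"
          using b by (intro tendsto_powr' tendsto_intros) (auto simp: eventually_at_filter)
        show ?thesis
          unfolding F_def continuous_within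
          using s by (intro tendsto_divide tendsto_minus tendsto_mult tendsto_diff tendsto_const A B) auto
      next
        case True
        \<comment> \<open>Near 0, \<open>F\<close> is \<open>w powr (1 - s)\<close> times this
          difference quotient, hence tends to 0. This agrees with \<open>F 0\<close>, because
          \<open>0 powr (- s)\<close> is 0.\<close>
        have "((\<lambda>w::real. (1 - (1 - w) powr b) / w) \<longlongrightarrow> b) (at_right 0)"
        proof -
          have "((\<lambda>w. 1 - (1 - w) powr b) has_real_derivative b) (at 0)"
            by (auto intro!: derivative_eq_intros)
          then have "((\<lambda>w. (1 - (1 - w) powr b) / w) \<longlongrightarrow> b) (at 0)"
            by (simp add: has_field_derivative_iff)
          then show ?thesis by (rule filterlim_at_split[THEN iffD1, THEN conjunct2])
        qed
        moreover have "((\<lambda>w::real. w powr (1 - s)) \<longlongrightarrow> 0 powr (1 - s)) (at_right 0)"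
          using s eventually_mono[OF eventually_at_right_less[of "0 :: real"], of "\<lambda>w. 0 \<le> w"]
          by (intro tendsto_powr' tendsto_ident_at tendsto_const) auto
        ultimately have "((\<lambda>w. - (w powr (1 - s) * ((1 - (1 - w) powr b) / w)) / s) \<longlongrightarrow> - (0 powr (1 - s) * b) / s) (at_right 0)"
          using s by (intro tendsto_divide tendsto_minus tendsto_mult tendsto_const) auto
        then have "(F \<longlongrightarrow> 0) (at_right 0)"
        proof (rule Lim_transform_eventually[THEN tendsto_eq_rhs])
          show "\<forall>\<^sub>F w in at_right 0. - (w powr (1 - s) * ((1 - (1 - w) powr b) / w)) / s = F w"
            using eventually_at_right_less[of 0]
            by eventually_elim (simp add: F_def powr_mult_base[of _ "- s", simplified, symmetric])
        qed auto
        moreover have "at 0 within {0..1::real} = at_right 0"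
          by (rule at_within_Icc_at_right) auto
        ultimately show ?thesis using True by (simp add: continuous_within F_def)
      qed
      then show ?thesis by (simp add: continuous_on_eq_continuous_within)
    qed
  next
    fix w :: real assume w: "w \<in> {0<..<1}"
    have e: "w powr (- s - 1) = w powr (- s) / w" using w by (simp add: powr_diff)
    have "(F has_real_derivative f w - b / s * h w) (at w)"
      unfolding F_def f_def h_def using w s
      by (auto intro!: derivative_eq_intros simp: field_simps e)
    then show "(F has_vector_derivative f w - b / s * h w) (at w)"
      by (simp add: has_real_derivative_iff_has_vector_derivative)
  qed auto
  moreover have "(h has_integral Beta (1 - s) b) {0..1}"
    unfolding h_def using s b by (intro has_integral_Beta_real) auto
  then have "((\<lambda>w. b / s * h w) has_integral b / s * Beta (1 - s) b) {0..1}"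
    by (rule has_integral_mult_right)
  ultimately have "((\<lambda>w. (f w - b / s * h w) + b / s * h w) has_integral (F 1 - F 0) + b / s * Beta (1 - s) b) {0..1}"
    by (rule has_integral_add)
  then show ?thesis by (simp add: F_def f_def algebra_simps)
qed

text \<open>The integral extends \<open>- Beta (- s) b\<close> analytically; it is reduced to a convergent Beta integral by
  \<open>(1 - w) powr (b - 1) = (1 - w) powr b + w * (1 - w) powr (b - 1)\<close> and integration by parts.\<close>

lemma has_bochner_integral_beta_defect:
  fixes s b :: real
  assumes s: "0 < s" "s < 1" and b: "0 < b"
  shows "has_bochner_integral lborel (\<lambda>w. indicator {0<..} w * (w powr (- s - 1) * beta_defect b w))
    (Gamma (1 - s) * Gamma b * rGamma (b - s) / s)"
proof -
  define f where "f = (\<lambda>w::real. w powr (- s - 1) * (1 - (1 - w) powr b))"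
  define h where "h = (\<lambda>w::real. w powr ((1 - s) - 1) * (1 - w) powr (b - 1))"
  have [measurable]: "f \<in> borel_measurable borel" "h \<in> borel_measurable borel"
    unfolding f_def h_def by measurable
  have 1: "has_bochner_integral lborel (\<lambda>w. indicator {0..1} w * f w) (b / s * Beta (1 - s) b - 1 / s)"
    using has_integral_powr_one_minus_powr[OF assms] b
    by (intro has_bochner_integral_nonneg_has_integral)
       (auto simp: f_def intro!: mult_nonneg_nonneg powr_le1)
  have 2: "has_bochner_integral lborel (\<lambda>w. indicator {0..1} w * h w) (Beta (1 - s) b)"
    using has_integral_Beta_real[of "1 - s" b] s b
    by (intro has_bochner_integral_nonneg_has_integral) (auto simp: h_def)
  \<comment> \<open>Beyond 1 the defect is 1; this tail cancels the boundary term
    \<open>- 1 / s\<close> of the first integral.\<close>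
  have 3: "has_bochner_integral lborel (\<lambda>w. indicator {1..} w * w powr (- s - 1)) (1 / s)"
    using has_integral_powr_to_inf[of "- s - 1" 1] s
    by (intro has_bochner_integral_nonneg_has_integral) auto
  have "has_bochner_integral lborel
      (\<lambda>w. indicator {0..1} w * f w - indicator {0..1} w * h w + indicator {1..} w * w powr (- s - 1))
      ((b / s * Beta (1 - s) b - 1 / s) - Beta (1 - s) b + 1 / s)"
    by (intro has_bochner_integral_add has_bochner_integral_diff 1 2 3)
  moreover have "(b / s * Beta (1 - s) b - 1 / s) - Beta (1 - s) b + 1 / s = Gamma (1 - s) * Gamma b * rGamma (b - s) / s"
  proof -
    \<comment> \<open>The recurrence in terms of \<open>rGamma\<close> stays valid when
      \<open>b - s\<close> is a pole of \<open>Gamma\<close>.\<close>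
    have "rGamma (b - s) = (b - s) * rGamma (1 - s + b)"
      using rGamma_plus1[of "b - s"] by (simp add: add.commute add_diff_eq)
    then have "Gamma (1 - s) * Gamma b * rGamma (b - s) / s = (b - s) / s * Beta (1 - s) b"
      by (simp add: Beta_altdef)
    then show ?thesis using s by (simp add: diff_divide_distrib left_diff_distrib)
  qed
  \<comment> \<open>At \<open>w = 1\<close> the closed intervals overlap and the two sides differ,
    hence equality only almost everywhere.\<close>
  moreover have "AE w in lborel. indicator {0..1} w * f w - indicator {0..1} w * h w + indicator {1..} w * w powr (- s - 1)
    = indicator {0<..} w * (w powr (- s - 1) * beta_defect b w)"
    using AE_lborel_singleton[of 1] AE_lborel_singleton[of 0]
  proof eventually_elim
    case (elim w)
    show ?case
    proof (cases "0 < w \<and> w < 1")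
      case True
      have "(1 - w) powr b = (1 - w) * (1 - w) powr (b - 1)" "w powr ((1 - s) - 1) = w * w powr (- s - 1)"
        using True by (simp_all add: powr_diff powr_minus field_simps)
      then have "f w - h w = w powr (- s - 1) * (1 - (1 - w) powr (b - 1))"
        unfolding f_def h_def by (simp only:) (simp add: algebra_simps)
      with True show ?thesis
        by (simp add: beta_defect_def)
    qed (use elim in \<open>auto simp: beta_defect_def indicator_def\<close>)
  qed
  ultimately show ?thesis
    by (subst (asm) has_bochner_integral_cong_AE) (auto simp: f_def h_def)
qed

section \<open>Integrability of powers of the norm\<close>

text \<open>The new variable \<open>m = l / (1 + l * T)\<close> makes the exponent linear again, so
  the result is a Laplace transform in \<open>q\<close>. Its bounded range is the origin of the
  cut-off in \<open>beta_defect\<close>.\<close>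

lemma nn_integral_moebius_substitution:
  fixes T \<alpha> \<nu> q :: real
  assumes "T > 0"
  shows "(\<integral>\<^sup>+l. ennreal (indicator {0<..} l * (l powr (\<alpha> - 1) * ((1 + l * T) powr (- \<nu>) * exp (- (l / (1 + l * T)) * q)))) \<partial>lborel)
    = (\<integral>\<^sup>+m. ennreal (indicator {0<..<1 / T} m * (m powr (\<alpha> - 1) * (1 - m * T) powr (\<nu> - \<alpha> - 1) * exp (- m * q))) \<partial>lborel)"
proof -
  define g where "g = (\<lambda>m. m / (1 - m * T))"
  define f where "f = (\<lambda>l. l powr (\<alpha> - 1) * ((1 + l * T) powr (- \<nu>) * exp (- (l / (1 + l * T)) * q)))"
  have [measurable]: "g \<in> borel_measurable borel" "f \<in> borel_measurable borel"
    unfolding g_def f_def by measurable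
  have pos: "0 < 1 - m * T" if "m \<in> {0<..<1 / T}" for m
    using that assms by (simp add: field_simps)
  have im: "g ` {0<..<1 / T} = {0<..}"
  proof (intro equalityI subsetI)
    fix l assume "l \<in> g ` {0<..<1 / T}"
    then show "l \<in> {0<..}" using pos by (auto simp: g_def)
  next
    fix l :: real assume l: "l \<in> {0<..}"
    then have p: "1 + l * T > 0" using assms by (simp add: add_pos_pos)
    have "l / (1 + l * T) \<in> {0<..<1 / T}" using l p assms by (simp add: field_simps)
    moreover have "g (l / (1 + l * T)) = l" using p by (simp add: g_def field_simps)
    ultimately show "l \<in> g ` {0<..<1 / T}" by (metis imageI)
  qed
  have inj: "inj_on g {0<..<1 / T}"
  proof (rule inj_onI)
    fix x y assume xy: "x \<in> {0<..<1 / T}" "y \<in> {0<..<1 / T}" "g x = g y"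
    have "x * (1 - y * T) = y * (1 - x * T)"
      using xy(3) pos[OF xy(1)] pos[OF xy(2)] by (simp add: g_def frac_eq_eq)
    then show "x = y" by (simp add: algebra_simps)
  qed
  have "(\<integral>\<^sup>+l. ennreal (indicator (g ` {0<..<1 / T}) l * f l) \<partial>lborel)
    = (\<integral>\<^sup>+m. ennreal (indicator {0<..<1 / T} m * (\<bar>1 / (1 - m * T)\<^sup>2\<bar> * f (g m))) \<partial>lborel)"
  proof (rule nn_integral_change_of_variables_real)
    fix m assume "m \<in> {0<..<1 / T}"
    from pos[OF this] show "(g has_real_derivative 1 / (1 - m * T)\<^sup>2) (at m)"
      unfolding g_def by (auto intro!: derivative_eq_intros simp: power2_eq_square)
  qed (auto simp: im inj f_def)
  also have "\<dots> = (\<integral>\<^sup>+m. ennreal (indicator {0<..<1 / T} m * (m powr (\<alpha> - 1) * (1 - m * T) powr (\<nu> - \<alpha> - 1) * exp (- m * q))) \<partial>lborel)"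
  proof (intro nn_integral_cong arg_cong[where f = ennreal])
    fix m :: real
    show "indicator {0<..<1 / T} m * (\<bar>1 / (1 - m * T)\<^sup>2\<bar> * f (g m))
      = indicator {0<..<1 / T} m * (m powr (\<alpha> - 1) * (1 - m * T) powr (\<nu> - \<alpha> - 1) * exp (- m * q))"
    proof (cases "m \<in> {0<..<1 / T}")
      case True
      define z where "z = 1 - m * T"
      have z: "z > 0" and m: "m > 0" using pos[OF True] True by (auto simp: z_def)
      have 1: "1 + g m * T = 1 / z" using z by (simp add: g_def z_def field_simps)
      have 2: "g m = m / z" by (simp add: g_def z_def)
      have A: "f (g m) = m powr (\<alpha> - 1) * (z powr (1 - \<alpha>) * z powr \<nu> * exp (- m * q))"
        unfolding f_def 1 unfolding 2 using z m
        by (simp add: powr_divide powr_minus powr_diff field_simps)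
      have B: "1 / z\<^sup>2 * (z powr (1 - \<alpha>) * z powr \<nu>) = z powr (\<nu> - \<alpha> - 1)"
        using z by (simp add: powr_diff powr_add power2_eq_square field_simps)
      have "1 / z\<^sup>2 * f (g m) = m powr (\<alpha> - 1) * z powr (\<nu> - \<alpha> - 1) * exp (- m * q)"
        unfolding A B[symmetric] by (simp only: mult.assoc mult.left_commute mult.commute)
      then show ?thesis using True by (simp add: z_def)
    qed auto
  qed
  finally show ?thesis by (simp add: im f_def)
qed

text \<open>Superposing the power by Gaussians makes the \<open>y\<close>-integral a Gaussian
  convolution, computed by completing the square. The result is a Laplace transform in the squared
  norm of \<open>x\<close>, ready to be compared with that of the power itself.\<close>

lemma nn_integral_norm_powr_gaussian:
  fixes x :: "'a::euclidean_space" and a T :: real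
  assumes "a > 0" "T > 0"
  shows "(\<integral>\<^sup>+y. ennreal (norm (x + y) powr (- a) * exp (- (norm y)\<^sup>2 / T)) \<partial>lborel)
    = ennreal ((pi * T) powr (real DIM('a) / 2) / Gamma (a / 2)) *
      (\<integral>\<^sup>+m. ennreal (indicator {0<..<1 / T} m *
         (m powr (a / 2 - 1) * (1 - m * T) powr (real DIM('a) / 2 - a / 2 - 1) * exp (- m * (norm x)\<^sup>2))) \<partial>lborel)"
proof -
  define N where "N = real DIM('a)"
  define G where "G = Gamma (a / 2)"
  have G: "G > 0" using assms by (simp add: G_def Gamma_real_pos)
  define h where "h = (\<lambda>l::real. indicator {0<..} l * l powr (a / 2 - 1) / G)"
  have [measurable]: "h \<in> borel_measurable borel" unfolding h_def by measurable
  have h0: "h l \<ge> 0" for l using G by (simp add: h_def)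
  have "(\<integral>\<^sup>+y. ennreal (norm (x + y) powr (- a) * exp (- (norm y)\<^sup>2 / T)) \<partial>lborel)
    = (\<integral>\<^sup>+y. \<integral>\<^sup>+l. ennreal (h l * (exp (- l * (norm (x + y))\<^sup>2) * exp (- (norm y)\<^sup>2 / T))) \<partial>lborel \<partial>lborel)"
  proof (rule nn_integral_cong_AE)
    show "AE y in lborel. ennreal (norm (x + y) powr (- a) * exp (- (norm y)\<^sup>2 / T))
      = (\<integral>\<^sup>+l. ennreal (h l * (exp (- l * (norm (x + y))\<^sup>2) * exp (- (norm y)\<^sup>2 / T))) \<partial>lborel)"
      \<comment> \<open>At \<open>y = - x\<close> the left side is 0, as
        \<open>0 powr (- a) = 0\<close>, whereas the superposition diverges.\<close>
      using AE_lborel_singleton[of "- x"]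
    proof eventually_elim
      case (elim y)
      define r where "r = norm (x + y)"
      have r: "r > 0" using elim by (auto simp: r_def add_eq_0_iff minus_equation_iff)
      have "(\<integral>\<^sup>+l. ennreal (h l * (exp (- l * r\<^sup>2) * exp (- (norm y)\<^sup>2 / T))) \<partial>lborel)
        = (\<integral>\<^sup>+l. ennreal (exp (- (norm y)\<^sup>2 / T) / G) * ennreal (indicator {0<..} l * (l powr (a / 2 - 1) * exp (- r\<^sup>2 * l))) \<partial>lborel)"
        using G by (intro nn_integral_cong) (simp add: h_def mult.commute mult.left_commute flip: ennreal_mult')
      also have "\<dots> = ennreal (exp (- (norm y)\<^sup>2 / T) / G) * ennreal (G * r\<^sup>2 powr (- (a / 2)))"
        using assms r nn_integral_powr_exp[of "a / 2" "r\<^sup>2"] unfolding G_def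
        by (subst nn_integral_cmult) auto
      also have "\<dots> = ennreal (r\<^sup>2 powr (- (a / 2)) * exp (- (norm y)\<^sup>2 / T))"
        using G by (subst ennreal_mult[symmetric]) (auto simp: field_simps)
      also have "r\<^sup>2 powr (- (a / 2)) = r powr (- a)"
        using r by (simp add: powr_powr flip: powr_numeral)
      finally show ?case by (simp add: r_def)
    qed
  qed
  also have "\<dots> = (\<integral>\<^sup>+l. \<integral>\<^sup>+y. ennreal (h l * (exp (- l * (norm (x + y))\<^sup>2) * exp (- (norm y)\<^sup>2 / T))) \<partial>lborel \<partial>lborel)"
    by (rule lborel_pair.Fubini') measurable
  also have "\<dots> = (\<integral>\<^sup>+l. ennreal ((pi * T) powr (N / 2) / G) *
       ennreal (indicator {0<..} l * (l powr (a / 2 - 1) * ((1 + l * T) powr (- (N / 2)) * exp (- (l / (1 + l * T)) * (norm x)\<^sup>2)))) \<partial>lborel)"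
  proof (rule nn_integral_cong)
    fix l :: real
    show "(\<integral>\<^sup>+y. ennreal (h l * (exp (- l * (norm (x + y))\<^sup>2) * exp (- (norm y)\<^sup>2 / T))) \<partial>lborel)
      = ennreal ((pi * T) powr (N / 2) / G) *
       ennreal (indicator {0<..} l * (l powr (a / 2 - 1) * ((1 + l * T) powr (- (N / 2)) * exp (- (l / (1 + l * T)) * (norm x)\<^sup>2))))"
    proof (cases "l > 0")
      case True
      have p: "1 + l * T > 0" using True assms by (simp add: add_pos_pos)
      \<comment> \<open>The product formula is applied with second rate \<open>1 / T\<close>; its
        output is rewritten in the form required by the Moebius substitution.\<close>
      have 1: "pi / (l + 1 / T) = (pi * T) / (1 + l * T)" using p assms by (simp add: field_simps)
      have 2: "l * (1 / T) / (l + 1 / T) = l / (1 + l * T)" using p assms by (simp add: field_simps)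
      have "(\<integral>\<^sup>+y. ennreal (h l * (exp (- l * (norm (x + y))\<^sup>2) * exp (- (norm y)\<^sup>2 / T))) \<partial>lborel)
        = ennreal (h l) * (\<integral>\<^sup>+y. ennreal (exp (- l * (norm (x + y))\<^sup>2) * exp (- (1 / T) * (norm y)\<^sup>2)) \<partial>lborel)"
        using h0[of l] by (subst nn_integral_cmult[symmetric]) (auto simp: ennreal_mult' intro!: nn_integral_cong)
      also have "\<dots> = ennreal (h l) * ennreal ((pi * T / (1 + l * T)) powr (N / 2) * exp (- (l / (1 + l * T)) * (norm x)\<^sup>2))"
        using True assms nn_integral_gaussian_product[of l "1 / T" x] by (simp only: 1 2 N_def zero_less_divide_1_iff)
      also have "\<dots> = ennreal (h l * ((pi * T / (1 + l * T)) powr (N / 2) * exp (- (l / (1 + l * T)) * (norm x)\<^sup>2)))"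
        using h0[of l] by (subst ennreal_mult) auto
      also have "h l * ((pi * T / (1 + l * T)) powr (N / 2) * exp (- (l / (1 + l * T)) * (norm x)\<^sup>2))
        = (pi * T) powr (N / 2) / G *
         (indicator {0<..} l * (l powr (a / 2 - 1) * ((1 + l * T) powr (- (N / 2)) * exp (- (l / (1 + l * T)) * (norm x)\<^sup>2))))"
        using True p assms by (simp add: h_def powr_divide powr_minus_divide)
      also have "ennreal \<dots> = ennreal ((pi * T) powr (N / 2) / G) *
         ennreal (indicator {0<..} l * (l powr (a / 2 - 1) * ((1 + l * T) powr (- (N / 2)) * exp (- (l / (1 + l * T)) * (norm x)\<^sup>2))))"
        using G by (intro ennreal_mult) auto
      finally show ?thesis .
    qed (simp add: h_def)
  qed
  also have "\<dots> = ennreal ((pi * T) powr (N / 2) / G) * (\<integral>\<^sup>+l.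
       ennreal (indicator {0<..} l * (l powr (a / 2 - 1) * ((1 + l * T) powr (- (N / 2)) * exp (- (l / (1 + l * T)) * (norm x)\<^sup>2)))) \<partial>lborel)"
    by (rule nn_integral_cmult) measurable
  finally show ?thesis
    unfolding nn_integral_moebius_substitution[OF assms(2)] N_def G_def .
qed

text \<open>For \<open>x = 0\<close> and \<open>T = 1\<close> the preceding formula is a Beta
  integral with parameters \<open>a / 2\<close> and \<open>(N - a) / 2\<close>, both
  positive.\<close>

lemma integrable_norm_powr_gaussian:
  fixes a :: real
  assumes "0 < a" "a < real DIM('a::euclidean_space)"
  shows "integrable lborel (\<lambda>y :: 'a. norm y powr (- a) * exp (- (norm y)\<^sup>2))"
proof (rule integrableI_nonneg)
  define f where "f = (\<lambda>m::real. m powr (a / 2 - 1) * (1 - m) powr (real DIM('a) / 2 - a / 2 - 1))"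
  have [measurable]: "f \<in> borel_measurable borel" unfolding f_def by measurable
  have "has_bochner_integral lborel (\<lambda>m. indicator {0..1} m * f m) (Beta (a / 2) (real DIM('a) / 2 - a / 2))"
    using has_integral_Beta_real[of "a / 2" "real DIM('a) / 2 - a / 2"] assms
    by (intro has_bochner_integral_nonneg_has_integral) (auto simp: f_def)
  then have fin: "(\<integral>\<^sup>+m. ennreal (indicator {0..1} m * f m) \<partial>lborel) < \<infinity>"
    by (subst nn_integral_eq_integral) (auto simp: has_bochner_integral_iff f_def indicator_def)
  have "(\<integral>\<^sup>+y. ennreal (norm y powr (- a) * exp (- (norm y)\<^sup>2)) \<partial>(lborel :: 'a measure))
    = ennreal (pi powr (real DIM('a) / 2) / Gamma (a / 2)) * (\<integral>\<^sup>+m. ennreal (indicator {0<..<1} m * f m) \<partial>lborel)"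
    using nn_integral_norm_powr_gaussian[of a 1 "0 :: 'a"] assms by (simp add: f_def)
  also have "\<dots> < \<infinity>"
  proof -
    have "(\<integral>\<^sup>+m. ennreal (indicator {0<..<1} m * f m) \<partial>lborel) \<le> (\<integral>\<^sup>+m. ennreal (indicator {0..1} m * f m) \<partial>lborel)"
      by (intro nn_integral_mono) (auto simp: indicator_def f_def)
    also note fin
    finally show ?thesis by (simp add: ennreal_mult_less_top)
  qed
  finally show "(\<integral>\<^sup>+y. ennreal (norm y powr (- a) * exp (- (norm y)\<^sup>2)) \<partial>(lborel :: 'a measure)) < \<infinity>" .
qed auto

text \<open>Superposing by \<open>exp (- (1 + (norm y)\<^sup>2) * l)\<close> and integrating in
  \<open>y\<close> first costs a factor \<open>l powr (- N / 2)\<close>, which leaves the Gamma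
  integral at \<open>s > 0\<close>.\<close>

lemma integrable_one_plus_norm_powr:
  fixes s :: real
  assumes "s > 0"
  shows "integrable lborel (\<lambda>y :: 'a::euclidean_space. (1 + (norm y)\<^sup>2) powr (- (real DIM('a) / 2 + s)))"
proof (rule integrableI_nonneg)
  define c where "c = real DIM('a) / 2 + s"
  have c: "c > 0" using assms by (simp add: c_def add_nonneg_pos)
  have "ennreal (Gamma c) * (\<integral>\<^sup>+y. ennreal ((1 + (norm y)\<^sup>2) powr (- c)) \<partial>(lborel :: 'a measure))
      = (\<integral>\<^sup>+y. ennreal (Gamma c * (1 + (norm y)\<^sup>2) powr (- c)) \<partial>(lborel :: 'a measure))"
    using c by (subst nn_integral_cmult[symmetric]) (auto simp: Gamma_real_pos less_imp_le ennreal_mult)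
  also have "\<dots> = (\<integral>\<^sup>+y. \<integral>\<^sup>+l. ennreal (indicator {0<..} l * (l powr (c - 1) * exp (- (1 + (norm y)\<^sup>2) * l))) \<partial>lborel \<partial>(lborel :: 'a measure))"
    using c by (subst nn_integral_powr_exp) (auto simp: add_pos_nonneg)
  also have "\<dots> = (\<integral>\<^sup>+l. \<integral>\<^sup>+y. ennreal (indicator {0<..} l * (l powr (c - 1) * exp (- (1 + (norm y)\<^sup>2) * l))) \<partial>(lborel :: 'a measure) \<partial>lborel)"
    by (rule lborel_pair.Fubini') measurable
  also have "\<dots> = (\<integral>\<^sup>+l. ennreal (pi powr (real DIM('a) / 2)) * ennreal (indicator {0<..} l * (l powr (s - 1) * exp (- 1 * l))) \<partial>lborel)"
  proof (rule nn_integral_cong)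
    fix l :: real
    show "(\<integral>\<^sup>+y. ennreal (indicator {0<..} l * (l powr (c - 1) * exp (- (1 + (norm y)\<^sup>2) * l))) \<partial>(lborel :: 'a measure))
      = ennreal (pi powr (real DIM('a) / 2)) * ennreal (indicator {0<..} l * (l powr (s - 1) * exp (- 1 * l)))"
    proof (cases "l > 0")
      case True
      have "(\<integral>\<^sup>+y. ennreal (indicator {0<..} l * (l powr (c - 1) * exp (- (1 + (norm y)\<^sup>2) * l))) \<partial>(lborel :: 'a measure))
        = (\<integral>\<^sup>+y. ennreal (l powr (c - 1) * exp (- l)) * ennreal (exp (- l * (norm y)\<^sup>2)) \<partial>(lborel :: 'a measure))"
        using True by (intro nn_integral_cong) (simp add: algebra_simps exp_add[symmetric] flip: ennreal_mult)
      also have "\<dots> = ennreal (l powr (c - 1) * exp (- l)) * ennreal ((pi / l) powr (real DIM('a) / 2))"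
        unfolding nn_integral_gaussian[OF True, where ?'a = 'a, symmetric] by (rule nn_integral_cmult) measurable
      also have "\<dots> = ennreal (pi powr (real DIM('a) / 2) * (l powr (s - 1) * exp (- l)))"
      proof -
        have "l powr (c - 1) / l powr (real DIM('a) / 2) = l powr (s - 1)"
          by (simp add: c_def flip: powr_diff)
        then have "l powr (c - 1) * exp (- l) * (pi / l) powr (real DIM('a) / 2) = pi powr (real DIM('a) / 2) * (l powr (s - 1) * exp (- l))"
          using True by (simp add: powr_divide) (simp add: field_simps)
        then show ?thesis by (simp flip: ennreal_mult)
      qed
      finally show ?thesis using True by (simp add: ennreal_mult)
    qed auto
  qed
  also have "\<dots> = ennreal (pi powr (real DIM('a) / 2)) * ennreal (Gamma s * 1 powr (- s))"
    unfolding nn_integral_powr_exp[OF assms zero_less_one, symmetric] by (rule nn_integral_cmult) measurable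
  also have "\<dots> < \<infinity>" by (simp add: ennreal_mult_less_top)
  finally have "ennreal (Gamma c) * (\<integral>\<^sup>+y. ennreal ((1 + (norm y)\<^sup>2) powr (- c)) \<partial>(lborel :: 'a measure)) < \<infinity>" .
  then show "(\<integral>\<^sup>+y. ennreal ((1 + (norm y)\<^sup>2) powr (- (real DIM('a) / 2 + s))) \<partial>(lborel :: 'a measure)) < \<infinity>"
    using Gamma_real_pos[OF c] by (auto simp: ennreal_mult_less_top c_def)
qed auto


text \<open>The dominating function of all later estimates: outside the unit ball the power is at
  most 1, and inside it the factor \<open>exp (1 - (norm z)\<^sup>2)\<close> is at least 1.\<close>

lemma norm_powr_le_gaussian:
  fixes z :: "'a::real_normed_vector"
  assumes "a > 0"
  shows "norm z powr (- a) \<le> 1 + exp 1 * (norm z powr (- a) * exp (- (norm z)\<^sup>2))"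
proof (cases "norm z < 1")
  case True
  then have "1 * norm z powr (- a) \<le> exp (1 - (norm z)\<^sup>2) * norm z powr (- a)"
    by (intro mult_right_mono) (auto simp: power_le_one)
  moreover have "exp (1 - (norm z)\<^sup>2) * norm z powr (- a) = exp 1 * (norm z powr (- a) * exp (- (norm z)\<^sup>2))"
    unfolding diff_conv_add_uminus exp_add by simp
  ultimately show ?thesis by linarith
next
  case False
  then have "norm z powr (- a) \<le> 1 powr (- a)"
    using assms by (intro powr_mono2') auto
  then show ?thesis by (simp add: add_increasing2)
qed

text \<open>\<open>c = 1\<close> is a translation and \<open>c = -1\<close> a point reflection;
  symmetrisation uses both.\<close>

lemma lborel_distr_isometry:
  fixes x :: "'a::euclidean_space"
  assumes "\<bar>c\<bar> = 1"
  shows "distr lborel borel (\<lambda>y. x + c *\<^sub>R y) = lborel"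
  using assms lborel_affine[of c x] by (auto simp: density_1)

lemma
  fixes f :: "'a::euclidean_space \<Rightarrow> real"
  assumes "\<bar>c\<bar> = 1" and [measurable]: "f \<in> borel_measurable borel"
  shows integrable_lborel_isometry: "integrable lborel (\<lambda>y. f (x + c *\<^sub>R y)) \<longleftrightarrow> integrable lborel f"
    and integral_lborel_isometry: "(\<integral>y. f (x + c *\<^sub>R y) \<partial>lborel) = (\<integral>y. f y \<partial>lborel)"
proof -
  have "integrable lborel f \<longleftrightarrow> integrable (distr lborel borel (\<lambda>y. x + c *\<^sub>R y)) f"
    by (simp add: lborel_distr_isometry[OF assms(1)])
  then show "integrable lborel (\<lambda>y. f (x + c *\<^sub>R y)) \<longleftrightarrow> integrable lborel f"
    by (simp add: integrable_distr_eq)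
  have "(\<integral>y. f y \<partial>lborel) = (\<integral>y. f y \<partial>distr lborel borel (\<lambda>y. x + c *\<^sub>R y))"
    by (simp add: lborel_distr_isometry[OF assms(1)])
  then show "(\<integral>y. f (x + c *\<^sub>R y) \<partial>lborel) = (\<integral>y. f y \<partial>lborel)"
    by (simp add: integral_distr)
qed

lemma integrable_norm_powr_tail:
  fixes s \<delta> :: real
  assumes "s > 0" "\<delta> > 0"
  shows "integrable lborel (\<lambda>y :: 'a::euclidean_space. indicator (- ball 0 \<delta>) y * norm y powr (- (real DIM('a) + 2 * s)))"
proof (rule Bochner_Integration.integrable_bound)
  define c where "c = real DIM('a) / 2 + s"
  \<comment> \<open>Chosen so that \<open>1 + (norm y)\<^sup>2 \<le> A * (norm y)\<^sup>2\<close>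
    outside the ball of radius \<open>\<delta>\<close>.\<close>
  define A where "A = 1 + 1 / \<delta>\<^sup>2"
  have A: "A > 0" using assms by (simp add: A_def add_pos_pos)
  show "integrable lborel (\<lambda>y :: 'a. A powr c * (1 + (norm y)\<^sup>2) powr (- c))"
    unfolding c_def by (intro integrable_mult_right integrable_one_plus_norm_powr assms)
  show "AE y :: 'a in lborel. norm (indicator (- ball 0 \<delta>) y * norm y powr (- (real DIM('a) + 2 * s)))
    \<le> norm (A powr c * (1 + (norm y)\<^sup>2) powr (- c))"
  proof (rule AE_I2)
    fix y :: 'a
    show "norm (indicator (- ball 0 \<delta>) y * norm y powr (- (real DIM('a) + 2 * s)))
      \<le> norm (A powr c * (1 + (norm y)\<^sup>2) powr (- c))"
    proof (cases "norm y < \<delta>")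
      case False
      then have y: "norm y > 0" "norm y \<ge> \<delta>" using assms by auto
      have "\<delta>\<^sup>2 \<le> (norm y)\<^sup>2" using y assms by (intro power_mono) auto
      then have "1 + (norm y)\<^sup>2 \<le> A * (norm y)\<^sup>2" using assms by (simp add: A_def field_simps)
      then have "(A * (norm y)\<^sup>2) powr (- c) \<le> (1 + (norm y)\<^sup>2) powr (- c)"
        using assms by (intro powr_mono2') (auto simp: c_def add_pos_nonneg)
      then have "A powr c * (A * (norm y)\<^sup>2) powr (- c) \<le> A powr c * (1 + (norm y)\<^sup>2) powr (- c)"
        by (rule mult_left_mono) simp
      moreover have "A powr c * (A * (norm y)\<^sup>2) powr (- c) = ((norm y)\<^sup>2) powr (- c)"
        using A by (simp add: powr_mult powr_minus)
      moreover have "((norm y)\<^sup>2) powr (- c) = norm y powr (- (real DIM('a) + 2 * s))"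
        using y by (simp add: c_def powr_powr distrib_left flip: powr_numeral)
      ultimately show ?thesis using False by (simp add: indicator_def)
    qed simp
  qed
qed measurable

section \<open>Second-order estimates for the power of the norm\<close>

text \<open>Taylor's formula with a second-order remainder. The bound on \<open>v\<close> keeps the
  intermediate point at or above \<open>q / 4\<close>, where the second derivative is largest at the
  left end.\<close>

lemma powr_second_order_bound:
  fixes \<alpha> q v :: real
  assumes "\<alpha> > 0" "q > 0" "\<bar>v\<bar> \<le> 3 / 4 * q"
  shows "\<bar>(q + v) powr (- \<alpha>) - q powr (- \<alpha>) + \<alpha> * q powr (- \<alpha> - 1) * v\<bar>
    \<le> \<alpha> * (\<alpha> + 1) * (q / 4) powr (- \<alpha> - 2) * v\<^sup>2"
proof (cases "v = 0")
  case False
  define diff where "diff = (\<lambda>(m::nat) x. if m = 0 then x powr (- \<alpha>)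
    else if m = 1 then - \<alpha> * x powr (- \<alpha> - 1) else \<alpha> * (\<alpha> + 1) * x powr (- \<alpha> - 2))"
  have D: "(diff m has_real_derivative diff (Suc m) t) (at t)" if "m < 2" "q / 4 \<le> t" for m t
  proof -
    have t: "t > 0" using that assms by simp
    from \<open>m < 2\<close> consider "m = 0" | "m = 1" by linarith
    then show ?thesis
    proof cases
      case 1
      then show ?thesis using t by (auto simp: diff_def[abs_def] intro!: derivative_eq_intros)
    next
      case 2
      then show ?thesis using t by (auto simp: diff_def[abs_def] algebra_simps intro!: derivative_eq_intros)
    qed
  qed
  have *: "\<exists>t. (if q + v < q then q + v < t \<and> t < q else q < t \<and> t < q + v) \<and>
      diff 0 (q + v) = (\<Sum>m<2. diff m q / fact m * (q + v - q) ^ m) + diff 2 t / fact 2 * (q + v - q) ^ 2"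
    using assms False D by (intro Taylor[where a = "q / 4" and b = "q + \<bar>v\<bar>"]) auto
  then obtain t where t: "q / 4 \<le> t"
    and eq: "diff 0 (q + v) = (\<Sum>m<2. diff m q / fact m * v ^ m) + diff 2 t / fact 2 * v ^ 2"
  proof -
    note le = abs_le_D1[OF assms(3)] abs_le_D2[OF assms(3)]
    then obtain t where "if q + v < q then q + v < t \<and> t < q else q < t \<and> t < q + v"
      "diff 0 (q + v) = (\<Sum>m<2. diff m q / fact m * v ^ m) + diff 2 t / fact 2 * v ^ 2"
      using * by auto
    moreover from this(1) have "q / 4 \<le> t" using le assms(2) by (simp split: if_splits)
    ultimately show ?thesis using that by blast
  qed
  have "(q + v) powr (- \<alpha>) - q powr (- \<alpha>) + \<alpha> * q powr (- \<alpha> - 1) * v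
    = \<alpha> * (\<alpha> + 1) * t powr (- \<alpha> - 2) / 2 * v\<^sup>2"
    using eq by (simp add: diff_def numeral_2_eq_2)
  also have "\<bar>\<dots>\<bar> = \<alpha> * (\<alpha> + 1) * (t powr (- \<alpha> - 2) / 2) * v\<^sup>2"
    using assms by (simp add: abs_mult)
  also have "\<dots> \<le> \<alpha> * (\<alpha> + 1) * (q / 4) powr (- \<alpha> - 2) * v\<^sup>2"
  proof (intro mult_right_mono mult_left_mono)
    have "t powr (- \<alpha> - 2) \<le> (q / 4) powr (- \<alpha> - 2)"
      using assms t by (intro powr_mono2') auto
    then show "t powr (- \<alpha> - 2) / 2 \<le> (q / 4) powr (- \<alpha> - 2)"
      using powr_ge_zero[of t "- \<alpha> - 2"] by linarith
  qed (use assms in auto)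
  finally show ?thesis .
qed simp

text \<open>The power is a smooth function of the squared norm, which moves from \<open>q\<close> by
  \<open>(norm y)\<^sup>2\<close> plus or minus \<open>2 * (x \<bullet> y)\<close>. In the average
  the inner products cancel at first order, and the rest is quadratic in
  \<open>norm y\<close>.\<close>

lemma norm_powr_second_difference_bound:
  fixes x :: "'a::euclidean_space"
  assumes "a > 0" "x \<noteq> 0"
  obtains M where "M \<ge> 0" "\<And>y. norm y \<le> norm x / 4 \<Longrightarrow>
    \<bar>norm x powr (- a) - (norm (x + y) powr (- a) + norm (x - y) powr (- a)) / 2\<bar> \<le> M * (norm y)\<^sup>2"
proof -
  define q where "q = (norm x)\<^sup>2"
  define \<alpha> where "\<alpha> = a / 2"
  define A where "A = \<alpha> * q powr (- \<alpha> - 1)"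
  define B where "B = \<alpha> * (\<alpha> + 1) * (q / 4) powr (- \<alpha> - 2)"
  have q: "q > 0" and \<alpha>: "\<alpha> > 0" using assms by (auto simp: q_def \<alpha>_def)
  have AB: "A \<ge> 0" "B \<ge> 0" using \<alpha> by (auto simp: A_def B_def)
  have pw: "norm z powr (- a) = ((norm z)\<^sup>2) powr (- \<alpha>)" for z :: 'a
    by (cases "z = 0") (simp_all add: \<alpha>_def powr_powr flip: powr_numeral)
  show ?thesis
  proof (rule that[of "A + B * (9 * q)"])
    show "0 \<le> A + B * (9 * q)" using AB q by simp
    fix y :: 'a assume y: "norm y \<le> norm x / 4"
    have *: "\<bar>(norm (x + e *\<^sub>R y))\<^sup>2 powr (- \<alpha>) - q powr (- \<alpha>) + A * ((norm y)\<^sup>2 + 2 * e * (x \<bullet> y))\<bar> \<le> B * (9 * q) * (norm y)\<^sup>2"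
      if e: "e = 1 \<or> e = -1" for e
    proof -
      define v where "v = (norm y)\<^sup>2 + 2 * e * (x \<bullet> y)"
      have 1: "(norm (x + e *\<^sub>R y))\<^sup>2 = q + v"
        using e by (auto simp: q_def v_def power2_norm_eq_inner inner_add_left inner_add_right inner_diff_left inner_diff_right inner_commute)
      have "\<bar>v\<bar> \<le> (norm y)\<^sup>2 + 2 * (norm x * norm y)"
        using e Cauchy_Schwarz_ineq2[of x y] abs_triangle_ineq[of "(norm y)\<^sup>2" "2 * e * (x \<bullet> y)"]
        unfolding v_def by (auto simp: abs_mult)
      also have "\<dots> \<le> norm y * (norm x / 4) + 2 * (norm x * norm y)"
        using mult_left_mono[OF y norm_ge_zero[of y]] by (simp add: power2_eq_square mult.commute)
      \<comment> \<open>Since \<open>norm y \<le> norm x / 4\<close>, this gives both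
        \<open>\<bar>v\<bar> \<le> 9 / 16 * q\<close>, inside the Taylor range, and
        \<open>v\<^sup>2 \<le> 81 / 16 * q * (norm y)\<^sup>2\<close>, rounded up to the factor
        9.\<close>
      finally have v: "\<bar>v\<bar> \<le> 9 / 4 * (norm x * norm y)" by (simp add: algebra_simps)
      also have "\<dots> \<le> 9 / 4 * (norm x * (norm x / 4))"
        using y by (intro mult_left_mono) auto
      also have "\<dots> \<le> 3 / 4 * q" by (simp add: q_def power2_eq_square)
      finally have "\<bar>(q + v) powr (- \<alpha>) - q powr (- \<alpha>) + A * v\<bar> \<le> B * v\<^sup>2"
        unfolding A_def B_def by (intro powr_second_order_bound \<alpha> q)
      also have "v\<^sup>2 \<le> (9 / 4 * (norm x * norm y))\<^sup>2"
        using v by (rule power2_le_iff_abs_le[THEN iffD2, rotated]) simp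
      also have "(9 / 4 * (norm x * norm y))\<^sup>2 = 81 / 16 * q * (norm y)\<^sup>2"
        by (simp add: q_def power_mult_distrib power_divide)
      also have "\<dots> \<le> 9 * q * (norm y)\<^sup>2"
        using q by (intro mult_right_mono) auto
      finally show ?thesis using AB by (simp add: 1 v_def mult_left_mono mult.assoc)
    qed
    have b1: "\<bar>(norm (x + y))\<^sup>2 powr (- \<alpha>) - q powr (- \<alpha>) + A * ((norm y)\<^sup>2 + 2 * (x \<bullet> y))\<bar> \<le> B * (9 * q) * (norm y)\<^sup>2"
      using *[of 1] by simp
    have b2: "\<bar>(norm (x - y))\<^sup>2 powr (- \<alpha>) - q powr (- \<alpha>) + A * ((norm y)\<^sup>2 - 2 * (x \<bullet> y))\<bar> \<le> B * (9 * q) * (norm y)\<^sup>2"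
      using *[of "-1"] by simp
    have arith: "\<bar>c - (u1 + u2) / 2\<bar> \<le> Y + K"
      if "\<bar>u1 - c + (Y + p)\<bar> \<le> K" "\<bar>u2 - c + (Y - p)\<bar> \<le> K" "Y \<ge> 0" for c u1 u2 K Y p :: real
      using that by argo
    show "\<bar>norm x powr (- a) - (norm (x + y) powr (- a) + norm (x - y) powr (- a)) / 2\<bar> \<le> (A + B * (9 * q)) * (norm y)\<^sup>2"
      unfolding pw q_def[symmetric] distrib_right
      using b1 b2 AB unfolding distrib_left right_diff_distrib by (intro arith) auto
  qed
qed

section \<open>The principal value as an absolutely convergent integral\<close>

text \<open>Half the negated second difference. Averaging over \<open>y\<close> and
  \<open>- y\<close> removes the odd part that makes the principal value only conditionally
  convergent.\<close>

definition sym_diff :: "real \<Rightarrow> 'a::euclidean_space \<Rightarrow> 'a \<Rightarrow> real" where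
  "sym_diff a x y = norm x powr (- a) - (norm (x + y) powr (- a) + norm (x - y) powr (- a)) / 2"

lemma measurable_sym_diff[measurable (raw)]:
  assumes [measurable]: "f \<in> borel_measurable M"
  shows "(\<lambda>y. sym_diff a x (f y)) \<in> borel_measurable M"
  unfolding sym_diff_def by measurable

text \<open>Two regimes: where the shifted power is at most 1 the kernel tail dominates, and near
  the singularity of the power the kernel is bounded by \<open>\<delta> powr (- k)\<close>.\<close>

lemma integrable_norm_powr_shift_tail:
  fixes x :: "'a::euclidean_space"
  assumes a: "0 < a" "a < real DIM('a)" and s: "s > 0" and \<delta>: "\<delta> > 0" and c: "\<bar>c\<bar> = 1"
  shows "integrable lborel (\<lambda>y. indicator (- ball 0 \<delta>) y * (norm (x + c *\<^sub>R y) powr (- a) * norm y powr (- (real DIM('a) + 2 * s))))"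
proof (rule Bochner_Integration.integrable_bound)
  define k where "k = real DIM('a) + 2 * s"
  have k: "k > 0" using s by (simp add: k_def add_nonneg_pos)
  let ?g = "\<lambda>z :: 'a. norm z powr (- a) * exp (- (norm z)\<^sup>2)"
  show "integrable lborel (\<lambda>y. indicator (- ball 0 \<delta>) y * norm y powr (- k) + \<delta> powr (- k) * exp 1 * ?g (x + c *\<^sub>R y))"
    using integrable_norm_powr_tail[OF s \<delta>, where ?'a = 'a] integrable_norm_powr_gaussian[OF a]
      integrable_lborel_isometry[OF c, of ?g x]
    by (intro Bochner_Integration.integrable_add integrable_mult_right) (auto simp: k_def)
  show "AE y in lborel. norm (indicator (- ball 0 \<delta>) y * (norm (x + c *\<^sub>R y) powr (- a) * norm y powr (- (real DIM('a) + 2 * s))))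
    \<le> norm (indicator (- ball 0 \<delta>) y * norm y powr (- k) + \<delta> powr (- k) * exp 1 * ?g (x + c *\<^sub>R y))"
  proof (rule AE_I2)
    fix y :: 'a
    show "norm (indicator (- ball 0 \<delta>) y * (norm (x + c *\<^sub>R y) powr (- a) * norm y powr (- (real DIM('a) + 2 * s))))
      \<le> norm (indicator (- ball 0 \<delta>) y * norm y powr (- k) + \<delta> powr (- k) * exp 1 * ?g (x + c *\<^sub>R y))"
    proof (cases "norm y < \<delta>")
      case False
      have "norm (x + c *\<^sub>R y) powr (- a) * norm y powr (- k) \<le> (1 + exp 1 * ?g (x + c *\<^sub>R y)) * norm y powr (- k)"
        using norm_powr_le_gaussian[OF a(1), of "x + c *\<^sub>R y"] by (intro mult_right_mono) auto
      also have "\<dots> \<le> norm y powr (- k) + \<delta> powr (- k) * exp 1 * ?g (x + c *\<^sub>R y)"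
      proof -
        have "norm y powr (- k) \<le> \<delta> powr (- k)"
          using False \<delta> k by (intro powr_mono2') auto
        then have "norm y powr (- k) * (exp 1 * ?g (x + c *\<^sub>R y)) \<le> \<delta> powr (- k) * (exp 1 * ?g (x + c *\<^sub>R y))"
          by (rule mult_right_mono) simp
        moreover have "(1 + e * g) * K \<le> K + D * e * g" if "K * (e * g) \<le> D * (e * g)" for e g D K :: real
          using that by (simp add: algebra_simps)
        ultimately show ?thesis by blast
      qed
      finally show ?thesis using False by (simp add: k_def indicator_def)
    qed (simp add: indicator_def)
  qed
qed measurable

lemma integrable_sym_diff_kernel:
  fixes x :: "'a::euclidean_space"
  assumes N: "DIM('a) \<ge> 2" and a: "0 < a" "a < real DIM('a)" and s: "0 < s" "s < 1" and x: "x \<noteq> 0"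
  shows "integrable lborel (\<lambda>y. sym_diff a x y * norm y powr (- (real DIM('a) + 2 * s)))"
proof -
  define k where "k = real DIM('a) + 2 * s"
  define \<delta> where "\<delta> = norm x / 4"
  have \<delta>: "\<delta> > 0" using x by (simp add: \<delta>_def)
  obtain M where M: "M \<ge> 0" "\<And>y. norm y \<le> \<delta> \<Longrightarrow> \<bar>sym_diff a x y\<bar> \<le> M * (norm y)\<^sup>2"
    using norm_powr_second_difference_bound[OF a(1) x] unfolding sym_diff_def \<delta>_def by blast
  have [measurable]: "ball (0 :: 'a) \<delta> \<in> sets borel" by simp
  have near: "integrable lborel (\<lambda>y. indicator (ball 0 \<delta>) y * (sym_diff a x y * norm y powr (- k)))"
  proof (rule Bochner_Integration.integrable_bound)
    \<comment> \<open>The quadratic bound improves the kernel exponent to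
      \<open>k - 2 = N + 2 * s - 2\<close>, which lies strictly between 0 and \<open>N\<close>
      because \<open>N \<ge> 2\<close> and \<open>0 < s < 1\<close>.\<close>
    show "integrable lborel (\<lambda>y :: 'a. M * exp (\<delta>\<^sup>2) * (norm y powr (- (k - 2)) * exp (- (norm y)\<^sup>2)))"
      using N s unfolding k_def by (intro integrable_mult_right integrable_norm_powr_gaussian) auto
    show "AE y in lborel. norm (indicator (ball 0 \<delta>) y * (sym_diff a x y * norm y powr (- k)))
      \<le> norm (M * exp (\<delta>\<^sup>2) * (norm y powr (- (k - 2)) * exp (- (norm y)\<^sup>2)))"
    proof (rule AE_I2)
      fix y :: 'a
      show "norm (indicator (ball 0 \<delta>) y * (sym_diff a x y * norm y powr (- k)))
        \<le> norm (M * exp (\<delta>\<^sup>2) * (norm y powr (- (k - 2)) * exp (- (norm y)\<^sup>2)))"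
      proof (cases "norm y < \<delta> \<and> y \<noteq> 0")
        case True
        have "\<bar>sym_diff a x y\<bar> * norm y powr (- k) \<le> M * (norm y)\<^sup>2 * norm y powr (- k)"
          using True M(2)[of y] by (intro mult_right_mono) auto
        also have "\<dots> = M * norm y powr (- (k - 2)) * 1"
          using True by (simp add: powr_diff powr_minus field_simps)
        also have "\<dots> \<le> M * norm y powr (- (k - 2)) * exp (\<delta>\<^sup>2 - (norm y)\<^sup>2)"
        proof (rule mult_left_mono)
          have "(norm y)\<^sup>2 \<le> \<delta>\<^sup>2" using True by (intro power_mono) auto
          then show "1 \<le> exp (\<delta>\<^sup>2 - (norm y)\<^sup>2)" by simp
        qed (use M in auto)
        also have "\<dots> = M * exp (\<delta>\<^sup>2) * (norm y powr (- (k - 2)) * exp (- (norm y)\<^sup>2))"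
          unfolding diff_conv_add_uminus exp_add by simp
        finally show ?thesis using True M by (simp add: indicator_def abs_mult)
      qed (use M in \<open>auto simp: indicator_def\<close>)
    qed
  qed measurable
  \<comment> \<open>Away from 0 no cancellation is required, and the three terms of
    \<open>sym_diff\<close> are integrable one by one.\<close>
  have "integrable lborel (\<lambda>y. norm x powr (- a) * (indicator (- ball 0 \<delta>) y * norm y powr (- k))
      - (indicator (- ball 0 \<delta>) y * (norm (x + 1 *\<^sub>R y) powr (- a) * norm y powr (- k))
        + indicator (- ball 0 \<delta>) y * (norm (x + (-1) *\<^sub>R y) powr (- a) * norm y powr (- k))) / 2)"
    unfolding k_def using a s \<delta>
    by (intro Bochner_Integration.integrable_diff Bochner_Integration.integrable_add integrable_mult_right
        integrable_divide integrable_norm_powr_tail integrable_norm_powr_shift_tail) auto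
  also have "(\<lambda>y. norm x powr (- a) * (indicator (- ball 0 \<delta>) y * norm y powr (- k))
      - (indicator (- ball 0 \<delta>) y * (norm (x + 1 *\<^sub>R y) powr (- a) * norm y powr (- k))
        + indicator (- ball 0 \<delta>) y * (norm (x + (-1) *\<^sub>R y) powr (- a) * norm y powr (- k))) / 2)
    = (\<lambda>y. indicator (- ball 0 \<delta>) y * (sym_diff a x y * norm y powr (- k)))"
    by (auto simp: sym_diff_def fun_eq_iff indicator_def algebra_simps add_divide_distrib)
  finally have far: "integrable lborel (\<lambda>y. indicator (- ball 0 \<delta>) y * (sym_diff a x y * norm y powr (- k)))" .
  have "integrable lborel (\<lambda>y. indicator (ball 0 \<delta>) y * (sym_diff a x y * norm y powr (- k))
      + indicator (- ball 0 \<delta>) y * (sym_diff a x y * norm y powr (- k)))"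
    by (intro Bochner_Integration.integrable_add near far)
  also have "(\<lambda>y. indicator (ball 0 \<delta>) y * (sym_diff a x y * norm y powr (- k))
      + indicator (- ball 0 \<delta>) y * (sym_diff a x y * norm y powr (- k)))
    = (\<lambda>y. sym_diff a x y * norm y powr (- k))"
    by (auto simp: fun_eq_iff indicator_def)
  finally show ?thesis unfolding k_def .
qed

lemma truncated_frac_laplacian_norm_powr:
  fixes x :: "'a::euclidean_space"
  assumes a: "0 < a" "a < real DIM('a)" and s: "0 < s" and \<epsilon>: "\<epsilon> > 0"
  shows "truncated_frac_laplacian s (\<lambda>z. norm z powr (- a)) x \<epsilon>
    = C_Ns DIM('a) s * (\<integral>y. indicator (- ball 0 \<epsilon>) y * (sym_diff a x y * norm y powr (- (real DIM('a) + 2 * s))) \<partial>lborel)"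
proof -
  define k where "k = real DIM('a) + 2 * s"
  define h where "h = (\<lambda>z :: 'a. indicator (- ball x \<epsilon>) z * ((norm x powr (- a) - norm z powr (- a)) / norm (x - z) powr k))"
  have [measurable]: "h \<in> borel_measurable borel" unfolding h_def by measurable
  have hc: "h (x + c *\<^sub>R y) = norm x powr (- a) * (indicator (- ball 0 \<epsilon>) y * norm y powr (- k))
      - indicator (- ball 0 \<epsilon>) y * (norm (x + c *\<^sub>R y) powr (- a) * norm y powr (- k))" if "\<bar>c\<bar> = 1" for c y
    using that by (simp add: h_def indicator_def dist_norm powr_minus_divide diff_divide_distrib)
  have int: "integrable lborel (\<lambda>y. h (x + c *\<^sub>R y))" if "\<bar>c\<bar> = 1" for c
    unfolding hc[OF that] unfolding k_def
    by (intro Bochner_Integration.integrable_diff integrable_mult_right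
        integrable_norm_powr_tail integrable_norm_powr_shift_tail assms that)
  have "(LINT z : - ball x \<epsilon> | lebesgue. (norm x powr (- a) - norm z powr (- a)) / norm (x - z) powr k) = (\<integral>z. h z \<partial>lebesgue)"
    by (simp add: set_lebesgue_integral_def h_def)
  also have "\<dots> = (\<integral>z. h z \<partial>lborel)" by (rule integral_completion) measurable
  \<comment> \<open>The same integral is taken in the variables \<open>z = x + y\<close> and
    \<open>z = x - y\<close> and averaged; the removed ball is symmetric about
    \<open>x\<close>.\<close>
  also have "\<dots> = ((\<integral>y. h (x + 1 *\<^sub>R y) \<partial>lborel) + (\<integral>y. h (x + (-1) *\<^sub>R y) \<partial>lborel)) / 2"
    by (subst (1 2) integral_lborel_isometry) auto
  also have "\<dots> = (\<integral>y. (h (x + 1 *\<^sub>R y) + h (x + (-1) *\<^sub>R y)) / 2 \<partial>lborel)"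
    using int[of 1] int[of "-1"] by simp
  also have "\<dots> = (\<integral>y. indicator (- ball 0 \<epsilon>) y * (sym_diff a x y * norm y powr (- k)) \<partial>lborel)"
  proof (rule Bochner_Integration.integral_cong)
    fix y
    have one: "\<bar>1\<bar> = (1 :: real)" "\<bar>-1\<bar> = (1 :: real)" by auto
    show "(h (x + 1 *\<^sub>R y) + h (x + (-1) *\<^sub>R y)) / 2 = indicator (- ball 0 \<epsilon>) y * (sym_diff a x y * norm y powr (- k))"
      unfolding hc[OF one(1)] hc[OF one(2)] by (simp add: sym_diff_def indicator_def field_simps)
  qed simp
  finally show ?thesis
    unfolding truncated_frac_laplacian_def k_def by simp
qed

lemma truncated_frac_laplacian_norm_powr_tendsto:
  fixes x :: "'a::euclidean_space"
  assumes N: "DIM('a) \<ge> 2" and a: "0 < a" "a < real DIM('a)" and s: "0 < s" "s < 1" and x: "x \<noteq> 0"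
  shows "(truncated_frac_laplacian s (\<lambda>z. norm z powr (- a)) x \<longlongrightarrow>
    C_Ns DIM('a) s * (\<integral>y. sym_diff a x y * norm y powr (- (real DIM('a) + 2 * s)) \<partial>lborel)) (at_right 0)"
proof -
  define G where "G = (\<lambda>y. sym_diff a x y * norm y powr (- (real DIM('a) + 2 * s)))"
  have G: "integrable lborel G" unfolding G_def by (intro integrable_sym_diff_kernel assms)
  have [measurable]: "G \<in> borel_measurable borel" unfolding G_def by measurable
  \<comment> \<open>Dominated convergence is used along \<open>at_top\<close>, with radius
    \<open>inverse t\<close>; the integrable \<open>\<bar>G\<bar>\<close> dominates.\<close>
  have "((\<lambda>t. \<integral>y. indicator (- ball 0 (inverse t)) y * G y \<partial>lborel) \<longlongrightarrow> (\<integral>y. G y \<partial>lborel)) at_top"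
  proof (rule integral_dominated_convergence_at_top)
    show "integrable lborel (\<lambda>y. norm (G y))" using G by (rule integrable_norm)
    show "\<forall>\<^sub>F t in at_top. AE y in lborel. norm (indicator (- ball 0 (inverse t)) y * G y) \<le> norm (G y)"
      by (intro always_eventually allI AE_I2) (auto simp: indicator_def)
    show "AE y in lborel. ((\<lambda>t. indicator (- ball 0 (inverse t)) y * G y) \<longlongrightarrow> G y) at_top"
      using AE_lborel_singleton[of 0]
    proof eventually_elim
      case (elim y)
      have "\<forall>\<^sub>F t in at_top. indicator (- ball 0 (inverse t)) y * G y = G y"
        using eventually_gt_at_top[of "inverse (norm y)"]
      proof eventually_elim
        case (elim t)
        with \<open>y \<noteq> 0\<close> have "inverse t < norm y"
          by (metis inverse_inverse_eq less_imp_inverse_less positive_imp_inverse_positive zero_less_norm_iff)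
        then show ?case by (simp add: indicator_def)
      qed
      then show ?case by (rule tendsto_eventually)
    qed
  qed measurable
  then have "((\<lambda>\<epsilon>. \<integral>y. indicator (- ball 0 \<epsilon>) y * G y \<partial>lborel) \<longlongrightarrow> (\<integral>y. G y \<partial>lborel)) (at_right 0)"
    by (simp add: filterlim_at_right_to_top)
  then have "((\<lambda>\<epsilon>. C_Ns DIM('a) s * (\<integral>y. indicator (- ball 0 \<epsilon>) y * G y \<partial>lborel)) \<longlongrightarrow> C_Ns DIM('a) s * (\<integral>y. G y \<partial>lborel)) (at_right 0)"
    by (intro tendsto_mult tendsto_const)
  then show ?thesis unfolding G_def
  proof (rule Lim_transform_eventually)
    show "\<forall>\<^sub>F \<epsilon> in at_right 0. C_Ns DIM('a) s * (\<integral>y. indicator (- ball 0 \<epsilon>) y * (sym_diff a x y * norm y powr (- (real DIM('a) + 2 * s))) \<partial>lborel)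
      = truncated_frac_laplacian s (\<lambda>z. norm z powr (- a)) x \<epsilon>"
      using eventually_at_right_less[of 0]
      by eventually_elim (simp add: truncated_frac_laplacian_norm_powr a s)
  qed
qed

section \<open>The fractional Laplacian of a power of the norm\<close>

text \<open>Up to normalisation this is a power minus its Gaussian average. Both are Laplace
  transforms in the squared norm of \<open>x\<close>, and subtracting the densities produces
  \<open>beta_defect\<close>.\<close>

lemma integral_sym_diff_gaussian:
  fixes x :: "'a::euclidean_space"
  assumes a: "0 < a" "a < real DIM('a)" and T: "T > 0" and x: "x \<noteq> 0"
  shows "(\<integral>y. sym_diff a x y * exp (- (norm y)\<^sup>2 / T) \<partial>lborel)
    = (pi * T) powr (real DIM('a) / 2) / Gamma (a / 2) *
      (\<integral>m. indicator {0<..} m * (m powr (a / 2 - 1) * exp (- m * (norm x)\<^sup>2) * beta_defect ((real DIM('a) - a) / 2) (m * T)) \<partial>lborel)"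
proof -
  define A where "A = (pi * T) powr (real DIM('a) / 2) / Gamma (a / 2)"
  define b where "b = (real DIM('a) - a) / 2"
  define g where "g = (\<lambda>y :: 'a. exp (- (norm y)\<^sup>2 / T))"
  have [measurable]: "g \<in> borel_measurable borel" unfolding g_def by measurable
  have A: "A > 0" using a T Gamma_real_pos[of "a / 2"] by (simp add: A_def)
  have g: "has_bochner_integral lborel g ((pi * T) powr (real DIM('a) / 2))"
  proof (rule has_bochner_integral_nn_integral)
    show "(\<integral>\<^sup>+y. ennreal (g y) \<partial>lborel) = ennreal ((pi * T) powr (real DIM('a) / 2))"
      using nn_integral_gaussian[of "1 / T", where ?'a = 'a] T by (simp add: g_def)
  qed (auto simp: g_def)
  let ?u = "\<lambda>z :: 'a. norm z powr (- a) * exp (- (norm z)\<^sup>2)"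
  have int: "integrable lborel (\<lambda>y. norm (x + c *\<^sub>R y) powr (- a) * g y)" if c: "\<bar>c\<bar> = 1" for c
  proof (rule Bochner_Integration.integrable_bound)
    show "integrable lborel (\<lambda>y. g y + exp 1 * ?u (x + c *\<^sub>R y))"
      using g integrable_norm_powr_gaussian[OF a] integrable_lborel_isometry[OF c, of ?u x]
      by (intro Bochner_Integration.integrable_add integrable_mult_right) (auto simp: has_bochner_integral_iff)
    show "AE y in lborel. norm (norm (x + c *\<^sub>R y) powr (- a) * g y) \<le> norm (g y + exp 1 * ?u (x + c *\<^sub>R y))"
    proof (rule AE_I2)
      fix y :: 'a
      have g1: "0 \<le> g y" "g y \<le> 1" using T by (auto simp: g_def)
      have "norm (x + c *\<^sub>R y) powr (- a) * g y \<le> (1 + exp 1 * ?u (x + c *\<^sub>R y)) * g y"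
        using norm_powr_le_gaussian[OF a(1), of "x + c *\<^sub>R y"] g1 by (intro mult_right_mono) auto
      also have "\<dots> \<le> g y + exp 1 * ?u (x + c *\<^sub>R y)"
        unfolding distrib_right using g1 mult_left_mono[OF g1(2), of "exp 1 * ?u (x + c *\<^sub>R y)"] by simp
      finally show "norm (norm (x + c *\<^sub>R y) powr (- a) * g y) \<le> norm (g y + exp 1 * ?u (x + c *\<^sub>R y))"
        using g1 by simp
    qed
  qed measurable
  \<comment> \<open>The Gaussian is even, so both shifts in \<open>sym_diff\<close> contribute the
    same average \<open>P\<close>.\<close>
  define P where "P = (\<integral>y. norm (x + y) powr (- a) * g y \<partial>lborel)"
  have P0: "P \<ge> 0" unfolding P_def by (intro integral_nonneg_AE AE_I2) (simp add: g_def)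
  have P1: "(\<integral>y. norm (x - y) powr (- a) * g y \<partial>lborel) = P"
    using integral_lborel_isometry[of "-1" "\<lambda>y. norm (x + y) powr (- a) * g y" 0]
    by (simp add: P_def g_def)
  have "(\<integral>y. sym_diff a x y * g y \<partial>lborel)
    = (\<integral>y. norm x powr (- a) * g y - (norm (x + y) powr (- a) * g y + norm (x - y) powr (- a) * g y) / 2 \<partial>lborel)"
    by (rule Bochner_Integration.integral_cong) (auto simp: sym_diff_def algebra_simps)
  also have "\<dots> = norm x powr (- a) * (pi * T) powr (real DIM('a) / 2) - P"
    using int[of 1] int[of "-1"] g P1 by (simp add: has_bochner_integral_iff flip: P_def)
  finally have 1: "(\<integral>y. sym_diff a x y * g y \<partial>lborel) = norm x powr (- a) * (pi * T) powr (real DIM('a) / 2) - P" .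
  \<comment> \<open>\<open>\<phi>\<close> belongs to the Gaussian average and \<open>\<psi>\<close>
    to the power itself; both are finite, so their integrals may be subtracted.\<close>
  define \<phi> where "\<phi> = (\<lambda>m. indicator {0<..<1 / T} m * (m powr (a / 2 - 1) * (1 - m * T) powr (b - 1) * exp (- m * (norm x)\<^sup>2)))"
  define \<psi> where "\<psi> = (\<lambda>m. indicator {0<..} m * (m powr (a / 2 - 1) * exp (- (norm x)\<^sup>2 * m)))"
  have \<phi>: "has_bochner_integral lborel \<phi> (P / A)"
  proof (rule has_bochner_integral_nn_integral)
    have be: "real DIM('a) / 2 - a / 2 - 1 = b - 1" by (simp add: b_def diff_divide_distrib)
    have "ennreal A * (\<integral>\<^sup>+m. ennreal (\<phi> m) \<partial>lborel) = (\<integral>\<^sup>+y. ennreal (norm (x + y) powr (- a) * g y) \<partial>lborel)"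
      unfolding nn_integral_norm_powr_gaussian[OF a(1) T, of x] A_def \<phi>_def g_def be ..
    also have "\<dots> = ennreal P"
      unfolding P_def using int[of 1] by (intro nn_integral_eq_integral) (auto simp: g_def)
    also have "\<dots> = ennreal A * ennreal (P / A)"
      using A P0 by (simp flip: ennreal_mult)
    finally show "(\<integral>\<^sup>+m. ennreal (\<phi> m) \<partial>lborel) = ennreal (P / A)"
      using A by (simp add: ennreal_mult_cancel_left)
  qed (use A P0 in \<open>auto simp: \<phi>_def\<close>)
  have \<psi>: "has_bochner_integral lborel \<psi> (Gamma (a / 2) * (norm x)\<^sup>2 powr (- (a / 2)))"
    using nn_integral_powr_exp[of "a / 2" "(norm x)\<^sup>2"] a x Gamma_real_pos[of "a / 2"]
    by (intro has_bochner_integral_nn_integral) (auto simp: \<psi>_def)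
  have eq: "\<psi> m - \<phi> m = indicator {0<..} m * (m powr (a / 2 - 1) * exp (- m * (norm x)\<^sup>2) * beta_defect b (m * T))" for m
    using T by (auto simp: \<phi>_def \<psi>_def beta_defect_def indicator_def field_simps)
  have "(\<integral>m. indicator {0<..} m * (m powr (a / 2 - 1) * exp (- m * (norm x)\<^sup>2) * beta_defect b (m * T)) \<partial>lborel)
    = Gamma (a / 2) * (norm x)\<^sup>2 powr (- (a / 2)) - P / A"
    using has_bochner_integral_diff[OF \<psi> \<phi>] unfolding eq by (simp add: has_bochner_integral_iff)
  moreover have "(norm x)\<^sup>2 powr (- (a / 2)) = norm x powr (- a)"
    using x by (simp add: powr_powr flip: powr_numeral)
  moreover have "A * (Gamma (a / 2) * norm x powr (- a) - P / A) = norm x powr (- a) * (pi * T) powr (real DIM('a) / 2) - P"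
    using A less_imp_neq[OF Gamma_real_pos[of "a / 2"]] a by (simp add: right_diff_distrib) (simp add: A_def)
  ultimately show ?thesis using 1 unfolding A_def b_def g_def by simp
qed

lemma has_bochner_integral_lborel_scale:
  fixes f :: "real \<Rightarrow> real"
  assumes "has_bochner_integral lborel f I" "c > 0"
  shows "has_bochner_integral lborel (\<lambda>t. f (c * t)) (I / c)"
  using lborel_has_bochner_integral_real_affine_iff[of c f I 0] assms by (simp add: field_simps)

text \<open>Integrating in \<open>T\<close> first, the scaling \<open>w = m * T\<close> separates
  the variables: a constant from the regularised Beta integral times \<open>m powr s\<close>, which
  raises the remaining Gamma integral from \<open>\<alpha>\<close> to
  \<open>\<alpha> + s\<close>.\<close>

lemma integral_beta_defect_powr_exp:
  fixes \<alpha> b q s :: real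
  assumes s: "0 < s" "s < 1" and b: "b > 0" and \<alpha>: "\<alpha> > 0" and q: "q > 0"
  shows "(\<integral>T. indicator {0<..} T * T powr (- s - 1) * (\<integral>m. indicator {0<..} m * (m powr (\<alpha> - 1) * exp (- m * q) * beta_defect b (m * T)) \<partial>lborel) \<partial>lborel)
    = Gamma (1 - s) * Gamma b * rGamma (b - s) / s * (Gamma (\<alpha> + s) * q powr (- (\<alpha> + s)))"
proof -
  define K where "K = Gamma (1 - s) * Gamma b * rGamma (b - s) / s"
  define k where "k = (\<lambda>w. indicator {0<..} w * (w powr (- s - 1) * beta_defect b w))"
  have k: "has_bochner_integral lborel k K" unfolding k_def K_def by (intro has_bochner_integral_beta_defect s b)
  then have k': "has_bochner_integral lborel (\<lambda>w. \<bar>k w\<bar>) (\<integral>w. \<bar>k w\<bar> \<partial>lborel)"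
    by (simp add: has_bochner_integral_iff)
  define \<psi> where "\<psi> = (\<lambda>m. indicator {0<..} m * (m powr (\<alpha> - 1) * exp (- m * q)))"
  define h where "h = (\<lambda>m. indicator {0<..} m * (m powr (\<alpha> + s - 1) * exp (- q * m)))"
  have h: "has_bochner_integral lborel h (Gamma (\<alpha> + s) * q powr (- (\<alpha> + s)))"
    using nn_integral_powr_exp[of "\<alpha> + s" q] \<alpha> s q Gamma_real_pos[of "\<alpha> + s"]
    by (intro has_bochner_integral_nn_integral) (auto simp: h_def)
  have h0: "h m \<ge> 0" for m by (simp add: h_def)
  define F where "F = (\<lambda>m T. \<psi> m * (indicator {0<..} T * T powr (- s - 1) * beta_defect b (m * T)))"
  have [measurable]: "case_prod F \<in> borel_measurable (lborel \<Otimes>\<^sub>M lborel)"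
    unfolding F_def \<psi>_def by measurable
  have F: "F m T = \<psi> m * m powr (s + 1) * k (m * T)" for m T
    by (cases "m > 0 \<and> T > 0")
       (auto simp: F_def k_def \<psi>_def indicator_def powr_mult zero_less_mult_iff simp flip: powr_add)
  \<comment> \<open>The division by \<open>m\<close> is the Jacobian of
    \<open>w = m * T\<close>.\<close>
  have hm: "\<psi> m * m powr (s + 1) / m = h m" for m
    by (cases "m > 0") (simp_all add: \<psi>_def h_def powr_add powr_diff field_simps)
  \<comment> \<open>The signed integral gives the value, and the one with absolute values justifies
    exchanging the order, since \<open>beta_defect\<close> may change sign.\<close>
  have FT: "has_bochner_integral lborel (\<lambda>T. F m T) (h m * K)"
           "has_bochner_integral lborel (\<lambda>T. \<bar>F m T\<bar>) (h m * (\<integral>w. \<bar>k w\<bar> \<partial>lborel))" for m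
  proof -
    have "has_bochner_integral lborel (\<lambda>T. F m T) (h m * K) \<and>
      has_bochner_integral lborel (\<lambda>T. \<bar>F m T\<bar>) (h m * (\<integral>w. \<bar>k w\<bar> \<partial>lborel))"
    proof (cases "m > 0")
      case True
      have "\<psi> m \<ge> 0" by (simp add: \<psi>_def)
      then have "\<bar>\<psi> m * m powr (s + 1) * k (m * T)\<bar> = \<psi> m * m powr (s + 1) * \<bar>k (m * T)\<bar>" for T
        by (simp add: abs_mult)
      then show ?thesis
        unfolding F hm[symmetric] using True
          has_bochner_integral_mult_right[OF has_bochner_integral_lborel_scale[OF k True], of "\<psi> m * m powr (s + 1)"]
          has_bochner_integral_mult_right[OF has_bochner_integral_lborel_scale[OF k' True], of "\<psi> m * m powr (s + 1)"]
        by simp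
    qed (simp add: F_def h_def \<psi>_def has_bochner_integral_zero)
    then show "has_bochner_integral lborel (\<lambda>T. F m T) (h m * K)"
      "has_bochner_integral lborel (\<lambda>T. \<bar>F m T\<bar>) (h m * (\<integral>w. \<bar>k w\<bar> \<partial>lborel))" by auto
  qed
  have int: "integrable (lborel \<Otimes>\<^sub>M lborel) (case_prod F)"
  proof (rule lborel_pair.Fubini_integrable)
    have "(\<integral>T. \<bar>F m T\<bar> \<partial>lborel) = h m * (\<integral>w. \<bar>k w\<bar> \<partial>lborel)" for m
      using FT(2) by (rule has_bochner_integral_integral_eq)
    then show "integrable lborel (\<lambda>m. \<integral>T. norm (case_prod F (m, T)) \<partial>lborel)"
      using h by (simp add: has_bochner_integral_iff)
    show "AE m in lborel. integrable lborel (\<lambda>T. case_prod F (m, T))"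
      using FT(1) by (auto simp: has_bochner_integral_iff)
  qed measurable
  have "(\<integral>T. indicator {0<..} T * T powr (- s - 1) * (\<integral>m. indicator {0<..} m * (m powr (\<alpha> - 1) * exp (- m * q) * beta_defect b (m * T)) \<partial>lborel) \<partial>lborel)
    = (\<integral>T. \<integral>m. F m T \<partial>lborel \<partial>lborel)"
    unfolding F_def \<psi>_def
    by (intro Bochner_Integration.integral_cong refl)
       (simp add: mult.assoc mult.left_commute flip: integral_mult_right_zero)
  also have "\<dots> = (\<integral>m. \<integral>T. F m T \<partial>lborel \<partial>lborel)"
    using int by (rule lborel_pair.Fubini_integral)
  also have "\<dots> = (\<integral>m. h m * K \<partial>lborel)"
    using has_bochner_integral_integral_eq[OF FT(1)] by simp
  also have "\<dots> = K * (Gamma (\<alpha> + s) * q powr (- (\<alpha> + s)))"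
    using h by (simp add: has_bochner_integral_iff)
  finally show ?thesis unfolding K_def .
qed

text \<open>The kernel is a superposition of Gaussians over widths \<open>T\<close> with exponent
  \<open>c = N / 2 + s\<close>. The order of integration can be exchanged because the weights are
  nonnegative: integrating absolute values in \<open>T\<close> returns \<open>\<bar>G\<bar>\<close>
  up to a constant.\<close>

lemma integral_sym_diff_kernel:
  fixes x :: "'a::euclidean_space"
  assumes N: "DIM('a) \<ge> 2" and a: "0 < a" "a < real DIM('a)" and s: "0 < s" "s < 1" and x: "x \<noteq> 0"
  shows "(\<integral>y. sym_diff a x y * norm y powr (- (real DIM('a) + 2 * s)) \<partial>lborel)
    = pi powr (real DIM('a) / 2) / (Gamma (real DIM('a) / 2 + s) * Gamma (a / 2)) *
      (Gamma (1 - s) * Gamma ((real DIM('a) - a) / 2) * rGamma ((real DIM('a) - a) / 2 - s) / s *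
        (Gamma (a / 2 + s) * norm x powr (- a - 2 * s)))"
proof -
  define c where "c = real DIM('a) / 2 + s"
  define b where "b = (real DIM('a) - a) / 2"
  have c: "c > 0" using s by (simp add: c_def add_nonneg_pos)
  define G where "G = (\<lambda>y. sym_diff a x y * norm y powr (- (real DIM('a) + 2 * s)))"
  have G: "integrable lborel G" unfolding G_def by (intro integrable_sym_diff_kernel assms)
  define w where "w = (\<lambda>(y :: 'a) T. indicator {0<..} T * (T powr (- c - 1) * exp (- (norm y)\<^sup>2 / T)))"
  have w0: "w y T \<ge> 0" for y T by (simp add: w_def)
  \<comment> \<open>At \<open>y = 0\<close> the integral in \<open>T\<close> diverges while
    \<open>powr\<close> returns 0, hence the almost-everywhere arguments below.\<close>
  have w: "has_bochner_integral lborel (\<lambda>T. w y T) (Gamma c * norm y powr (- (real DIM('a) + 2 * s)))" if "y \<noteq> 0" for y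
  proof (rule has_bochner_integral_nn_integral)
    have "((norm y)\<^sup>2) powr (- c) = norm y powr (- (real DIM('a) + 2 * s))"
      using that by (simp add: c_def powr_powr distrib_left flip: powr_numeral)
    then show "(\<integral>\<^sup>+T. ennreal (w y T) \<partial>lborel) = ennreal (Gamma c * norm y powr (- (real DIM('a) + 2 * s)))"
      using nn_integral_powr_exp_inverse[OF c, of "(norm y)\<^sup>2"] that by (simp add: w_def)
  qed (use c Gamma_real_pos[of c] in \<open>auto simp: w_def\<close>)
  define F where "F = (\<lambda>y T. sym_diff a x y * w y T)"
  have [measurable]: "case_prod F \<in> borel_measurable (lborel \<Otimes>\<^sub>M lborel)"
    unfolding F_def w_def by measurable
  have FT: "has_bochner_integral lborel (\<lambda>T. F y T) (Gamma c * G y)"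
    "has_bochner_integral lborel (\<lambda>T. \<bar>F y T\<bar>) (Gamma c * \<bar>G y\<bar>)" if "y \<noteq> 0" for y
    using has_bochner_integral_mult_right[OF w[OF that], of "sym_diff a x y"]
      has_bochner_integral_mult_right[OF w[OF that], of "\<bar>sym_diff a x y\<bar>"] w0
    by (simp_all add: F_def G_def abs_mult mult.left_commute)
  have int: "integrable (lborel \<Otimes>\<^sub>M lborel) (case_prod F)"
  proof (rule lborel_pair.Fubini_integrable)
    have "integrable lborel (\<lambda>y. Gamma c * \<bar>G y\<bar>)"
      using G by (intro integrable_mult_right integrable_abs)
    also have "?this \<longleftrightarrow> integrable lborel (\<lambda>y. \<integral>T. norm (case_prod F (y, T)) \<partial>lborel)"
    proof (rule integrable_cong_AE)
      show "AE y in lborel. Gamma c * \<bar>G y\<bar> = (\<integral>T. norm (case_prod F (y, T)) \<partial>lborel)"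
        using AE_lborel_singleton[of 0]
        by eventually_elim (use FT(2) in \<open>simp add: has_bochner_integral_iff\<close>)
    qed (use G in measurable)
    finally show "integrable lborel (\<lambda>y. \<integral>T. norm (case_prod F (y, T)) \<partial>lborel)" .
    show "AE y in lborel. integrable lborel (\<lambda>T. case_prod F (y, T))"
      using AE_lborel_singleton[of 0]
      by eventually_elim (use FT(1) in \<open>simp add: has_bochner_integral_iff\<close>)
  qed measurable
  have "Gamma c * (\<integral>y. G y \<partial>lborel) = (\<integral>y. Gamma c * G y \<partial>lborel)" by simp
  also have "\<dots> = (\<integral>y. \<integral>T. F y T \<partial>lborel \<partial>lborel)"
  proof (rule integral_cong_AE)
    show "AE y in lborel. Gamma c * G y = (\<integral>T. F y T \<partial>lborel)"
      using AE_lborel_singleton[of 0]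
      by eventually_elim (use FT(1) in \<open>simp add: has_bochner_integral_iff\<close>)
  qed (use G in measurable)
  also have "\<dots> = (\<integral>T. \<integral>y. F y T \<partial>lborel \<partial>lborel)"
    using int by (rule lborel_pair.Fubini_integral[symmetric])
  also have "\<dots> = (\<integral>T. pi powr (real DIM('a) / 2) / Gamma (a / 2) * (indicator {0<..} T * T powr (- s - 1) *
    (\<integral>m. indicator {0<..} m * (m powr (a / 2 - 1) * exp (- m * (norm x)\<^sup>2) * beta_defect b (m * T)) \<partial>lborel)) \<partial>lborel)"
  proof (rule Bochner_Integration.integral_cong)
    fix T :: real
    show "(\<integral>y. F y T \<partial>lborel) = pi powr (real DIM('a) / 2) / Gamma (a / 2) * (indicator {0<..} T * T powr (- s - 1) *
      (\<integral>m. indicator {0<..} m * (m powr (a / 2 - 1) * exp (- m * (norm x)\<^sup>2) * beta_defect b (m * T)) \<partial>lborel))"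
    proof (cases "T > 0")
      case True
      have "(\<integral>y. F y T \<partial>lborel) = T powr (- c - 1) * (\<integral>y. sym_diff a x y * exp (- (norm y)\<^sup>2 / T) \<partial>lborel)"
        using True unfolding integral_mult_right_zero[symmetric]
        by (intro Bochner_Integration.integral_cong refl) (simp add: F_def w_def)
      also have "\<dots> = T powr (- c - 1) * ((pi * T) powr (real DIM('a) / 2) / Gamma (a / 2) *
        (\<integral>m. indicator {0<..} m * (m powr (a / 2 - 1) * exp (- m * (norm x)\<^sup>2) * beta_defect b (m * T)) \<partial>lborel))"
        unfolding integral_sym_diff_gaussian[OF a True x] b_def ..
      \<comment> \<open>The mass of the Gaussian absorbs the dimension from \<open>c\<close>,
        leaving the weight of the regularised Beta integral.\<close>
      also have "T powr (- c - 1) * (pi * T) powr (real DIM('a) / 2) = pi powr (real DIM('a) / 2) * T powr (- s - 1)"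
        using True by (simp add: c_def powr_mult flip: powr_add)
      then have "T powr (- c - 1) * ((pi * T) powr (real DIM('a) / 2) / Gamma (a / 2) * I)
        = pi powr (real DIM('a) / 2) / Gamma (a / 2) * (T powr (- s - 1) * I)" for I
        by (simp add: field_simps)
      finally show ?thesis using True by simp
    qed (simp add: F_def w_def)
  qed simp
  also have "\<dots> = pi powr (real DIM('a) / 2) / Gamma (a / 2) *
    (Gamma (1 - s) * Gamma b * rGamma (b - s) / s * (Gamma (a / 2 + s) * (norm x)\<^sup>2 powr (- (a / 2 + s))))"
    using a s x unfolding integral_mult_right_zero
    by (subst integral_beta_defect_powr_exp) (auto simp: b_def)
  also have "(norm x)\<^sup>2 powr (- (a / 2 + s)) = norm x powr (- a - 2 * s)"
    using x by (simp add: powr_powr distrib_left flip: powr_numeral)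
  finally have "Gamma c * (\<integral>y. G y \<partial>lborel) = pi powr (real DIM('a) / 2) / Gamma (a / 2) *
    (Gamma (1 - s) * Gamma b * rGamma (b - s) / s * (Gamma (a / 2 + s) * norm x powr (- a - 2 * s)))" .
  moreover have "V = P / (g * D) * Z" if "g * V = P / D * Z" "g > 0" for g V P D Z :: real
    using that by (cases "D = 0") (simp_all add: field_simps)
  ultimately show ?thesis
    using Gamma_real_pos[OF c] unfolding G_def b_def c_def by blast
qed

text \<open>The normalisation \<open>C_Ns\<close> cancels the powers of \<open>pi\<close>, the
  factor \<open>s\<close> and the Gamma values at \<open>1 - s\<close> and \<open>N / 2 + s\<close>;
  the four factors depending on \<open>a\<close> are those of \<open>c_s\<close>.\<close>

theorem frac_laplacian_norm_powr:
  fixes x :: "'a::euclidean_space"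
  assumes N: "DIM('a) \<ge> 2" and a: "0 < a" "a < real DIM('a)" and s: "0 < s" "s < 1" and x: "x \<noteq> 0"
  shows "(truncated_frac_laplacian s (\<lambda>z. norm z powr (- a)) x \<longlongrightarrow>
    c_s DIM('a) s (- a) * norm x powr (- a - 2 * s)) (at_right 0)"
proof -
  have G: "Gamma (1 - s) > 0" "Gamma (real DIM('a) / 2 + s) > 0" "Gamma (a / 2) > 0"
    using a s by (auto intro!: Gamma_real_pos add_nonneg_pos)
  have "C_Ns DIM('a) s * (\<integral>y. sym_diff a x y * norm y powr (- (real DIM('a) + 2 * s)) \<partial>lborel)
    = 2 powr (2 * s) * pi powr (- real DIM('a) / 2) * s * (Gamma (real DIM('a) / 2 + s) / Gamma (1 - s)) *
      (pi powr (real DIM('a) / 2) / (Gamma (real DIM('a) / 2 + s) * Gamma (a / 2)) *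
      (Gamma (1 - s) * Gamma ((real DIM('a) - a) / 2) * rGamma ((real DIM('a) - a) / 2 - s) / s *
        (Gamma (a / 2 + s) * norm x powr (- a - 2 * s))))"
    unfolding integral_sym_diff_kernel[OF assms] C_Ns_def by (simp add: add_divide_distrib)
  also have "\<dots> = 2 powr (2 * s) * (Gamma ((real DIM('a) - a) / 2) * Gamma (a / 2 + s)) *
      (rGamma (a / 2) * rGamma ((real DIM('a) - a) / 2 - s)) * norm x powr (- a - 2 * s)"
  proof -
    have alg: "A * P' * s * (B / C) * (P / (B * D) * (C * E * R / s * (F * X))) = A * (E * F) * (inverse D * R) * X"
      if "B \<noteq> 0" "C \<noteq> 0" "P' * P = 1" for A B C D E F P P' R X :: real
    proof -
      have "A * P' * s * (B / C) * (P / (B * D) * (C * E * R / s * (F * X)))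
        = (P' * P) * (A * (E * F) * (inverse D * R) * X)"
        using that(1,2) s by (cases "D = 0") (simp_all add: field_simps)
      then show ?thesis using that(3) by simp
    qed
    have pp: "pi powr (- real DIM('a) / 2) * pi powr (real DIM('a) / 2) = 1"
      by (simp flip: powr_add)
    show ?thesis unfolding rGamma_inverse_Gamma[of "a / 2"]
      by (rule alg) (use G pp in auto)
  qed
  also have "\<dots> = c_s DIM('a) s (- a) * norm x powr (- a - 2 * s)"
    by (simp add: c_s_def add_divide_distrib diff_divide_distrib algebra_simps)
  finally show ?thesis
    using truncated_frac_laplacian_norm_powr_tendsto[OF assms] by simp
qed

section \<open>The supersolutions\<close>

text \<open>The reflection of \<open>\<tau>\<close> to \<open>2 * s - N - \<tau>\<close> swaps the
  Gamma arguments in pairs; at its fixed point they coincide, which yields the squares in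
  \<open>mu0\<close>.\<close>

lemma c_s_midpoint: "c_s N s ((2 * s - real N) / 2) = - mu0 N s"
proof -
  have eqs: "(real N + (2 * s - real N) / 2) / 2 = (real N + 2 * s) / 4"
    "(2 * s - (2 * s - real N) / 2) / 2 = (real N + 2 * s) / 4"
    "- ((2 * s - real N) / 2) / 2 = (real N - 2 * s) / 4"
    "(real N - 2 * s + (2 * s - real N) / 2) / 2 = (real N - 2 * s) / 4"
    by (simp_all add: field_simps)
  show ?thesis
    unfolding c_s_def mu0_def eqs by (simp add: rGamma_inverse_Gamma inverse_eq_divide power2_eq_square)
qed

text \<open>After multiplication by \<open>(N + \<tau>) / 2\<close> the pole of \<open>c_s\<close> at \<open>- N\<close> disappears, and the value
  there is negative because of the factor \<open>rGamma (- s)\<close>.\<close>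

lemma tau_minus_less_midpoint:
  assumes N: "N \<ge> 2" and s: "0 < s" "s < 1" and \<mu>: "\<mu> > mu0 N s"
  shows "tau_minus N s \<mu> < (2 * s - real N) / 2"
proof -
  define m where "m = (2 * s - real N) / 2"
  define h where "h = (\<lambda>\<tau>. 2 powr (2 * s) * (Gamma ((real N + \<tau>) / 2 + 1) * Gamma ((2 * s - \<tau>) / 2))
      * (rGamma (- \<tau> / 2) * rGamma ((real N - 2 * s + \<tau>) / 2)) + (real N + \<tau>) / 2 * \<mu>)"
  have m: "- real N < m" "m < 0" using N s by (auto simp: m_def field_simps)
  have h_eq: "h \<tau> = (real N + \<tau>) / 2 * (c_s N s \<tau> + \<mu>)" if "- real N < \<tau>" for \<tau>
  proof -
    define z where "z = (real N + \<tau>) / 2"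
    have "z \<notin> \<int>\<^sub>\<le>\<^sub>0" using that by (auto simp: z_def)
    then have "Gamma (z + 1) = z * Gamma z" by (rule Gamma_plus1)
    then show ?thesis unfolding h_def c_s_def z_def[symmetric] by (simp add: distrib_left)
  qed
  have cont: "continuous_on {- real N..m} h"
  proof -
    have A: "continuous_on {- real N..m} (\<lambda>\<tau>. Gamma ((real N + \<tau>) / 2 + 1))"
      by (rule continuous_on_compose2[OF continuous_on_Gamma[of "{0<..}"]])
         (auto intro!: continuous_intros add_nonneg_pos)
    have B: "continuous_on {- real N..m} (\<lambda>\<tau>. Gamma ((2 * s - \<tau>) / 2))"
      by (rule continuous_on_compose2[OF continuous_on_Gamma[of "{0<..}"]])
         (use m s in \<open>auto intro!: continuous_intros\<close>)
    have C: "continuous_on {- real N..m} (\<lambda>\<tau>. rGamma (- \<tau> / 2))"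
      by (rule continuous_on_compose2[OF continuous_on_rGamma[of UNIV]]) (auto intro!: continuous_intros)
    have D: "continuous_on {- real N..m} (\<lambda>\<tau>. rGamma ((real N - 2 * s + \<tau>) / 2))"
      by (rule continuous_on_compose2[OF continuous_on_rGamma[of UNIV]]) (auto intro!: continuous_intros)
    show ?thesis
      unfolding h_def
      by (intro continuous_on_add continuous_on_mult continuous_on_divide continuous_on_const continuous_on_id A B C D) simp
  qed
  have "h (- real N) < 0"
  proof -
    have "rGamma (- s) = - s * rGamma (1 - s)" using rGamma_plus1[of "- s"] by simp
    moreover have "rGamma (1 - s) > 0" "rGamma (real N / 2) > 0" "Gamma (s + real N / 2) > 0"
      using s N Gamma_real_pos[of "1 - s"] Gamma_real_pos[of "real N / 2"] Gamma_real_pos[of "s + real N / 2"]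
      by (auto simp: rGamma_inverse_Gamma)
    moreover have "h (- real N) = - (2 powr (2 * s) * Gamma (s + real N / 2) * (rGamma (real N / 2) * (s * rGamma (1 - s))))"
    proof -
      have eqs: "(real N + - real N) / 2 + 1 = 1" "(2 * s - - real N) / 2 = s + real N / 2"
        "- (- real N) / 2 = real N / 2" "(real N - 2 * s + - real N) / 2 = - s" "(real N + - real N) / 2 * \<mu> = 0"
        by simp_all
      show ?thesis unfolding h_def eqs using calculation(1) by simp
    qed
    ultimately show ?thesis using s by simp
  qed
  moreover have "c_s N s m + \<mu> > 0" unfolding m_def c_s_midpoint using \<mu> by simp
  then have hm: "h m > 0" unfolding h_eq[OF m(1)] using m by (intro mult_pos_pos) auto
  ultimately obtain \<tau>1 where \<tau>1: "\<tau>1 \<in> {- real N..m}" "h \<tau>1 = 0"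
    using IVT'[of h "- real N" 0 m, OF _ _ _ cont] m by auto
  \<comment> \<open>\<open>LEAST\<close> over the reals needs an attained minimum: the zeros of
    \<open>h\<close> up to \<open>m\<close> form a compact set, and the sign of \<open>h\<close> at
    the endpoints excludes both.\<close>
  define Z where "Z = {- real N..m} \<inter> h -` {0}"
  have "closed Z" unfolding Z_def using cont by (intro continuous_closed_preimage) auto
  moreover have "bounded Z" by (rule bounded_subset[of "{- real N..m}"]) (auto simp: Z_def)
  ultimately have "compact Z" by (simp add: compact_eq_bounded_closed)
  moreover have "Z \<noteq> {}" using \<tau>1 by (auto simp: Z_def)
  ultimately obtain \<tau> where \<tau>: "\<tau> \<in> Z" "\<And>y. y \<in> Z \<Longrightarrow> \<tau> \<le> y"
    using compact_attains_inf[of Z] by auto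
  have "\<tau> \<noteq> - real N" "\<tau> \<noteq> m" using \<tau>(1) \<open>h (- real N) < 0\<close> hm by (auto simp: Z_def)
  then have \<tau>m: "- real N < \<tau>" "\<tau> < m" using \<tau>(1) by (auto simp: Z_def)
  have "tau_minus N s \<mu> = \<tau>"
    unfolding tau_minus_def
  proof (rule Least_equality)
    show "- real N < \<tau> \<and> \<tau> < 2 * s \<and> c_s N s \<tau> + \<mu> = 0"
    proof -
      have "(real N + \<tau>) / 2 * (c_s N s \<tau> + \<mu>) = 0"
        using \<tau>(1) unfolding h_eq[OF \<tau>m(1), symmetric] by (simp add: Z_def)
      then show ?thesis using \<tau>m m s by simp
    qed
    fix y assume y: "- real N < y \<and> y < 2 * s \<and> c_s N s y + \<mu> = 0"
    show "\<tau> \<le> y"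
    \<comment> \<open>A zero to the right of \<open>m\<close> already exceeds
      \<open>\<tau>\<close>.\<close>
    proof (cases "y \<le> m")
      case True
      have "h y = 0" using y by (subst h_eq) auto
      then have "y \<in> Z" using y True by (simp add: Z_def)
      then show ?thesis by (rule \<tau>(2))
    qed (use \<tau>m in auto)
  qed
  then show ?thesis using \<tau>m by (simp add: m_def)
qed

section \<open>Multiples of the power as solutions\<close>

lemma norm_powr_in_L1s:
  assumes a: "0 < a" "a < real DIM('a)" and s: "0 < s" and t: "t \<ge> 0"
  shows "(\<lambda>x :: 'a::euclidean_space. t * norm x powr (- a)) \<in> L1s s"
proof -
  let ?g = "\<lambda>z :: 'a. norm z powr (- a) * exp (- (norm z)\<^sup>2)"
  have gi: "integrable lborel ?g" by (rule integrable_norm_powr_gaussian[OF a])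
  have "set_integrable lebesgue K (\<lambda>x :: 'a. t * norm x powr (- a))" if K: "compact K" for K
  proof -
    have [measurable]: "K \<in> sets borel" using K by (simp add: compact_imp_closed borel_closed)
    have "integrable lborel (\<lambda>x. indicator K x * (t * norm x powr (- a)))"
    proof (rule Bochner_Integration.integrable_bound)
      have "integrable lborel (\<lambda>x. indicator K x :: real)"
        using K emeasure_compact_finite[of K] by (intro integrable_real_indicator) auto
      then show "integrable lborel (\<lambda>x. t * indicator K x + t * exp 1 * ?g x)"
        using gi by (intro Bochner_Integration.integrable_add integrable_mult_right)
      show "AE x in lborel. norm (indicator K x * (t * norm x powr (- a))) \<le> norm (t * indicator K x + t * exp 1 * ?g x)"
      proof (rule AE_I2)
        fix x :: 'a
        have "t * norm x powr (- a) \<le> t * (1 + exp 1 * ?g x)"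
          using norm_powr_le_gaussian[OF a(1), of x] t by (rule mult_left_mono)
        then show "norm (indicator K x * (t * norm x powr (- a))) \<le> norm (t * indicator K x + t * exp 1 * ?g x)"
          using t by (auto simp: indicator_def distrib_left mult.assoc)
      qed
    qed measurable
    then show ?thesis
      unfolding set_integrable_def by (subst integrable_completion) auto
  qed
  moreover have "integrable lebesgue (\<lambda>x :: 'a. \<bar>t * norm x powr (- a)\<bar> / (1 + norm x powr (real DIM('a) + 2 * s)))"
  proof -
    have "integrable lborel (\<lambda>x :: 'a. \<bar>t * norm x powr (- a)\<bar> / (1 + norm x powr (real DIM('a) + 2 * s)))"
    proof (rule Bochner_Integration.integrable_bound)
      let ?h = "\<lambda>x :: 'a. indicator (- ball 0 1) x * norm x powr (- (real DIM('a) + 2 * s)) :: real"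
      show "integrable lborel (\<lambda>x. t * ?h x + t * exp 1 * ?g x)"
        by (intro Bochner_Integration.integrable_add integrable_mult_right integrable_norm_powr_tail gi s) simp
      show "AE x in lborel. norm (\<bar>t * norm x powr (- a)\<bar> / (1 + norm x powr (real DIM('a) + 2 * s)))
        \<le> norm (t * ?h x + t * exp 1 * ?g x)"
      proof (rule AE_I2)
        fix x :: 'a
        define P where "P = norm x powr (real DIM('a) + 2 * s)"
        have P: "P \<ge> 0" by (simp add: P_def)
        \<comment> \<open>Inside the unit ball the weight is at most 1 and \<open>?g\<close>
          controls the singularity; outside the power is at most 1 and the weight decays like the
          kernel.\<close>
        have "norm x powr (- a) / (1 + P) \<le> ?h x + exp 1 * ?g x"
        proof (cases "norm x < 1")
          case True
          have "norm x powr (- a) / (1 + P) \<le> norm x powr (- a)"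
            using P by (simp add: divide_le_eq mult_left_le add_increasing mult_le_cancel_left1)
          also have "\<dots> = exp (1 - 1) * norm x powr (- a)" by simp
          also have "\<dots> \<le> exp (1 - (norm x)\<^sup>2) * norm x powr (- a)"
            using True by (intro mult_right_mono) (auto simp: power_le_one)
          also have "\<dots> = exp 1 * ?g x" unfolding diff_conv_add_uminus exp_add by simp
          finally show ?thesis using True by simp
        next
          case False
          have "norm x powr (- a) \<le> 1 powr (- a)" using False a by (intro powr_mono2') auto
          then have "norm x powr (- a) / (1 + P) \<le> 1 / P"
            using False P by (intro frac_le) (auto simp: P_def)
          also have "1 / P = norm x powr (- (real DIM('a) + 2 * s))" unfolding P_def powr_minus_divide ..
          also have "\<dots> = ?h x" using False by (simp add: indicator_def)
          finally show ?thesis by (simp add: add_increasing2)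
        qed
        from mult_left_mono[OF this t]
        show "norm (\<bar>t * norm x powr (- a)\<bar> / (1 + norm x powr (real DIM('a) + 2 * s)))
          \<le> norm (t * ?h x + t * exp 1 * ?g x)"
          using t P unfolding P_def by (simp add: distrib_left abs_mult)
      qed
    qed measurable
    then show ?thesis by (subst integrable_completion) auto
  qed
  ultimately show ?thesis by (simp add: L1s_def)
qed

lemma truncated_frac_laplacian_cmult:
  "truncated_frac_laplacian s (\<lambda>z. t * v z) x \<epsilon> = t * truncated_frac_laplacian s v x \<epsilon>"
  unfolding truncated_frac_laplacian_def
  by (simp add: mult.left_commute flip: set_integral_mult_right right_diff_distrib times_divide_eq_right)

text \<open>Both terms of the operator lower the degree of homogeneity by \<open>2 * s\<close>, so
  they merge into one coefficient.\<close>

lemma hardy_op_norm_powr: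
  fixes x :: "'a::euclidean_space"
  assumes N: "DIM('a) \<ge> 2" and a: "0 < a" "a < real DIM('a)" and s: "0 < s" "s < 1" and x: "x \<noteq> 0"
  shows "frac_laplacian_exists s (\<lambda>z. t * norm z powr (- a)) x"
    and "hardy_op s \<mu> (\<lambda>z. t * norm z powr (- a)) x = t * (c_s DIM('a) s (- a) + \<mu>) * norm x powr (- a - 2 * s)"
proof -
  have lim: "(truncated_frac_laplacian s (\<lambda>z. t * norm z powr (- a)) x \<longlongrightarrow>
    t * (c_s DIM('a) s (- a) * norm x powr (- a - 2 * s))) (at_right 0)"
    unfolding truncated_frac_laplacian_cmult[abs_def]
    by (intro tendsto_mult tendsto_const frac_laplacian_norm_powr assms)
  then show "frac_laplacian_exists s (\<lambda>z. t * norm z powr (- a)) x"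
    unfolding frac_laplacian_exists_def by blast
  have "frac_laplacian s (\<lambda>z. t * norm z powr (- a)) x = t * (c_s DIM('a) s (- a) * norm x powr (- a - 2 * s))"
    unfolding frac_laplacian_def using lim by (intro tendsto_Lim) auto
  then show "hardy_op s \<mu> (\<lambda>z. t * norm z powr (- a)) x = t * (c_s DIM('a) s (- a) + \<mu>) * norm x powr (- a - 2 * s)"
    by (simp add: hardy_op_def powr_diff) (simp add: algebra_simps add_divide_distrib)
qed

text \<open>The limit superior controls \<open>Q\<close> outside some ball of radius
  \<open>R\<close>; on the compact shell in between, which avoids the origin, Hoelder continuity
  bounds it.\<close>

lemma weight_le_norm_powr:
  fixes Q :: "'a::euclidean_space \<Rightarrow> real"
  assumes "0 < \<beta>" "locally_Holder_on \<beta> (- {0}) Q" "\<theta> \<le> 0" "\<delta> > 0"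
    and lim: "Limsup at_infinity (\<lambda>x. ereal (Q x * norm x powr (- \<theta>))) < \<infinity>"
  obtains M where "M > 0" "\<And>x. norm x \<ge> \<delta> \<Longrightarrow> Q x \<le> M * norm x powr \<theta>"
proof -
  obtain P where P: "eventually P at_infinity" and "(SUP x\<in>Collect P. ereal (Q x * norm x powr (- \<theta>))) < \<infinity>"
    using lim unfolding Limsup_def INF_less_iff by auto
  then obtain n :: nat where n: "(SUP x\<in>Collect P. ereal (Q x * norm x powr (- \<theta>))) < ereal (real n)"
    using less_PInf_Ex_of_nat by (metis less_irrefl)
  have far: "Q x * norm x powr (- \<theta>) \<le> real n" if "P x" for x
  proof -
    have "ereal (Q x * norm x powr (- \<theta>)) \<le> (SUP x\<in>Collect P. ereal (Q x * norm x powr (- \<theta>)))"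
      using that by (intro SUP_upper) auto
    also note n
    finally show ?thesis by simp
  qed
  obtain R where R: "\<And>x. norm x \<ge> R \<Longrightarrow> P x" using P unfolding eventually_at_infinity by auto
  define K where "K = cball 0 R - ball (0 :: 'a) \<delta>"
  have "compact K" unfolding K_def by (intro compact_diff compact_cball open_ball)
  moreover have "K \<subseteq> - {0}" unfolding K_def using assms(4) by auto
  ultimately have "\<exists>C. \<forall>x\<in>K. \<forall>y\<in>K. \<bar>Q x - Q y\<bar> \<le> C * dist x y powr \<beta>"
    using assms(2) unfolding locally_Holder_on_def by simp
  then obtain C where C: "\<forall>x\<in>K. \<forall>y\<in>K. \<bar>Q x - Q y\<bar> \<le> C * dist x y powr \<beta>" ..
  obtain B where B: "\<And>x. x \<in> K \<Longrightarrow> Q x \<le> B" "B \<ge> 0"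
  proof (cases "K = {}")
    case False
    then obtain y where y: "y \<in> K" by auto
    have "Q x \<le> \<bar>Q y\<bar> + \<bar>C\<bar> * (2 * R) powr \<beta>" if x: "x \<in> K" for x
    proof -
      have "dist x y \<le> norm x + norm y" by (simp add: dist_norm norm_triangle_ineq4)
      then have "dist x y powr \<beta> \<le> (2 * R) powr \<beta>"
        using x y assms(1) by (intro powr_mono2) (auto simp: K_def)
      then have "\<bar>C\<bar> * dist x y powr \<beta> \<le> \<bar>C\<bar> * (2 * R) powr \<beta>" by (rule mult_left_mono) simp
      moreover have "C * dist x y powr \<beta> \<le> \<bar>C\<bar> * dist x y powr \<beta>" by (rule mult_right_mono) auto
      ultimately show ?thesis using bspec[OF bspec[OF C x] y] by linarith
    qed
    then show ?thesis by (intro that[of "\<bar>Q y\<bar> + \<bar>C\<bar> * (2 * R) powr \<beta>"]) auto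
  qed (use that[of 0] in auto)
  \<comment> \<open>The far bound plus the shell bound, where \<open>\<theta> \<le> 0\<close> gives
    \<open>norm x powr (- \<theta>) \<le> R powr (- \<theta>)\<close>; the 1 ensures
    positivity.\<close>
  define M where "M = real n + B * R powr (- \<theta>) + 1"
  show ?thesis
  proof (rule that[of M])
    show "M > 0" using B by (simp add: M_def add_nonneg_pos)
    fix x :: 'a assume x: "norm x \<ge> \<delta>"
    have "Q x * norm x powr (- \<theta>) \<le> M"
    proof (cases "norm x \<ge> R")
      case True
      have "0 \<le> B * R powr (- \<theta>)" using B by simp
      then show ?thesis using far[OF R[OF True]] unfolding M_def by linarith
    next
      case False
      then have "x \<in> K" using x by (simp add: K_def)
      then have "Q x * norm x powr (- \<theta>) \<le> B * norm x powr (- \<theta>)"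
        by (intro mult_right_mono B) auto
      also have "\<dots> \<le> B * R powr (- \<theta>)"
        using False B assms(3) by (intro mult_left_mono powr_mono2) auto
      finally show ?thesis by (simp add: M_def)
    qed
    then have "Q x * norm x powr (- \<theta>) * norm x powr \<theta> \<le> M * norm x powr \<theta>"
      by (rule mult_right_mono) simp
    moreover have "norm x powr (- \<theta>) * norm x powr \<theta> = 1"
    proof -
      have "norm x > 0" using x assms(4) by linarith
      then show ?thesis by (simp flip: powr_add)
    qed
    ultimately show "Q x \<le> M * norm x powr \<theta>" by (simp add: mult.assoc)
  qed
qed

text \<open>After division by \<open>t powr p * r powr (- a - 2 * s)\<close> the claim reads
  \<open>M * r powr e \<le> t powr (1 - p) * \<kappa>\<close>. As \<open>e \<le> 0\<close>, the
  worst radius is \<open>\<delta>\<close>, and the threshold for \<open>t\<close> is equality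
  there.\<close>

lemma powr_supersolution:
  fixes t r a p \<kappa> M \<delta> e s \<theta> :: real
  assumes "0 < \<delta>" "\<delta> \<le> r" "0 < t" "0 < \<kappa>" "0 < M" "p < 1"
    and t: "(M * \<delta> powr e / \<kappa>) powr (1 / (1 - p)) \<le> t"
    and e: "e = \<theta> + 2 * s + a * (1 - p)" "e \<le> 0"
  shows "M * r powr \<theta> * (t * r powr (- a)) powr p \<le> t * \<kappa> * r powr (- a - 2 * s)"
proof -
  have r: "r > 0" using assms by linarith
  have "((M * \<delta> powr e / \<kappa>) powr (1 / (1 - p))) powr (1 - p) \<le> t powr (1 - p)"
    using t assms by (intro powr_mono2) auto
  then have "M * \<delta> powr e / \<kappa> \<le> t powr (1 - p)"
    using assms by (simp add: powr_powr)
  then have 1: "M * \<delta> powr e \<le> t powr (1 - p) * \<kappa>" using assms by (simp add: divide_le_eq)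
  have "r powr e \<le> \<delta> powr e" using assms by (intro powr_mono2') auto
  then have "M * r powr e \<le> t powr (1 - p) * \<kappa>"
    using 1 assms by (meson less_imp_le mult_left_mono order_trans)
  then have le: "(M * r powr e) * (t powr p * r powr (- a - 2 * s)) \<le> (t powr (1 - p) * \<kappa>) * (t powr p * r powr (- a - 2 * s))"
    by (rule mult_right_mono) simp
  have re: "r powr e * r powr (- a - 2 * s) = r powr \<theta> * r powr (- a * p)"
    by (simp add: e(1) algebra_simps flip: powr_add)
  have "M * r powr \<theta> * (t * r powr (- a)) powr p = M * t powr p * (r powr e * r powr (- a - 2 * s))"
    unfolding re using assms r by (simp add: powr_mult powr_powr)
  also have "\<dots> = (M * r powr e) * (t powr p * r powr (- a - 2 * s))" by simp
  also note le
  also have "(t powr (1 - p) * \<kappa>) * (t powr p * r powr (- a - 2 * s)) = (t powr (1 - p) * t powr p) * \<kappa> * r powr (- a - 2 * s)"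
    by simp
  also have "t powr (1 - p) * t powr p = t" using assms by (simp flip: powr_add)
  finally show ?thesis .
qed

theorem theorem1p5:
  fixes \<Omega> :: "'a::euclidean_space set" and Q :: "'a \<Rightarrow> real" and s \<mu> \<beta> \<theta> p :: real
  assumes "DIM('a) \<ge> 2"
    and "0 < s" and "s < 1"
    and "bounded_C2_domain \<Omega>" and "0 \<in> \<Omega>"
    and "\<mu> > mu0 DIM('a) s"
    and "0 < \<beta>" and "\<beta> < 1" and "locally_Holder_on \<beta> (- {0}) Q"
    and "\<And>x. x \<noteq> 0 \<Longrightarrow> Q x > 0"
    and "Liminf at_infinity (\<lambda>x. ereal (Q x * norm x powr (- \<theta>))) > 0"
    and "Limsup at_infinity (\<lambda>x. ereal (Q x * norm x powr (- \<theta>))) < \<infinity>"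
    and "tau_minus DIM('a) s \<mu> - 2 * s < \<theta>" and "\<theta> < - 2 * s"
    and "p = p_star DIM('a) s \<mu> \<theta>" and "0 < p" and "p < 1"
  shows "infinite ({u. positive_classical_solution s \<mu> \<Omega> Q p u} // ae_eq)"
proof -
  define a where "a = (real DIM('a) - 2 * s) / 2"
  define \<kappa> where "\<kappa> = c_s DIM('a) s (- a) + \<mu>"
  define u where "u = (\<lambda>t (x :: 'a). t * norm x powr (- a))"
  have a: "0 < a" "a < real DIM('a)" using assms(1-3) by (auto simp: a_def field_simps)
  have ma: "- a = (2 * s - real DIM('a)) / 2" by (simp add: a_def field_simps)
  have \<kappa>: "\<kappa> > 0" unfolding \<kappa>_def ma c_s_midpoint using assms(6) by simp
  have \<tau>: "tau_minus DIM('a) s \<mu> < - a"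
    unfolding ma by (intro tau_minus_less_midpoint assms)
  define e where "e = \<theta> + 2 * s + a * (1 - p)"
  \<comment> \<open>By the choice of \<open>p\<close>, \<open>e\<close> equals
    \<open>(1 - p) * (tau_minus + a)\<close>.\<close>
  have "e \<le> 0"
  proof -
    have "1 - p = (2 * s + \<theta>) / tau_minus DIM('a) s \<mu>" by (simp add: assms(15) p_star_def)
    then have "(1 - p) * tau_minus DIM('a) s \<mu> = 2 * s + \<theta>" using \<tau> a by simp
    moreover have "(1 - p) * tau_minus DIM('a) s \<mu> \<le> (1 - p) * (- a)"
      using \<tau> assms(17) by (intro mult_left_mono) auto
    ultimately show ?thesis by (simp add: e_def mult.commute)
  qed
  obtain \<delta> where \<delta>: "\<delta> > 0" "ball 0 \<delta> \<subseteq> \<Omega>"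
    using assms(4,5) unfolding bounded_C2_domain_def by (meson openE)
  have out: "norm x \<ge> \<delta>" "x \<noteq> 0" if "x \<in> - closure \<Omega>" for x
  proof -
    have "x \<notin> ball 0 \<delta>" using that \<delta>(2) closure_subset by blast
    then show "norm x \<ge> \<delta>" "x \<noteq> 0" using \<delta>(1) by auto
  qed
  obtain M where M: "M > 0" "\<And>x. norm x \<ge> \<delta> \<Longrightarrow> Q x \<le> M * norm x powr \<theta>"
    using weight_le_norm_powr[OF assms(7,9) _ \<delta>(1) assms(12)] assms(2,14) by auto
  define t0 where "t0 = (M * \<delta> powr e / \<kappa>) powr (1 / (1 - p))"
  have t0: "t0 > 0" unfolding t0_def using M \<delta> \<kappa> by simp
  have sol: "positive_classical_solution s \<mu> \<Omega> Q p (u t)" if t: "t \<ge> t0" for t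
  proof -
    have tpos: "t > 0" using t t0 by linarith
    have "u t \<in> L1s s" unfolding u_def using tpos by (intro norm_powr_in_L1s assms a) simp
    moreover have "continuous_on (- closure \<Omega>) (u t)"
      unfolding u_def using out(2) by (intro continuous_intros) auto
    moreover have "frac_laplacian_exists s (u t) x \<and> hardy_op s \<mu> (u t) x \<ge> Q x * u t x powr p"
      if x: "x \<in> - closure \<Omega>" for x
    proof
      note hardy = hardy_op_norm_powr[OF assms(1) a assms(2,3) out(2)[OF x], where t = t]
      show "frac_laplacian_exists s (u t) x" unfolding u_def by (rule hardy(1))
      have "Q x * u t x powr p \<le> M * norm x powr \<theta> * u t x powr p"
        using M(2)[OF out(1)[OF x]] by (rule mult_right_mono) simp
      also have "\<dots> \<le> t * \<kappa> * norm x powr (- a - 2 * s)"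
        unfolding u_def
        by (rule powr_supersolution[OF \<delta>(1) out(1)[OF x] tpos \<kappa> M(1) assms(17) _ e_def \<open>e \<le> 0\<close>])
           (use t in \<open>simp add: t0_def\<close>)
      also have "\<dots> = hardy_op s \<mu> (u t) x" unfolding u_def hardy(2) \<kappa>_def ..
      finally show "hardy_op s \<mu> (u t) x \<ge> Q x * u t x powr p" .
    qed
    moreover have "\<forall>x\<in>closure \<Omega>. u t x \<ge> 0" using tpos by (simp add: u_def)
    moreover have "AE x in lebesgue. x \<in> - closure \<Omega> \<longrightarrow> u t x > 0"
      using tpos out(2) by (intro AE_I2) (auto simp: u_def)
    ultimately show ?thesis
      unfolding positive_classical_solution_def classical_solution_def by blast
  qed
  \<comment> \<open>Lebesgue measure is nonzero, so functions equal almost everywhere agree at some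
    point other than 0, and one such value determines \<open>t\<close>.\<close>
  have "inj_on (\<lambda>t. ae_eq `` {u t}) {t0..}"
  proof (rule inj_onI)
    fix t t' assume "ae_eq `` {u t} = ae_eq `` {u t'}"
    moreover have "u t' \<in> ae_eq `` {u t'}" by (simp add: ae_eq_def)
    ultimately have "AE x in lebesgue. u t x = u t' x" unfolding ae_eq_def by auto
    then have "AE x in lborel. u t x = u t' x"
      by (subst (asm) AE_completion_iff) (auto simp: u_def)
    then have "AE x in lborel. x \<noteq> 0 \<and> u t x = u t' x"
      using AE_lborel_singleton[of "0 :: 'a"] by eventually_elim auto
    moreover have "ae_filter (lborel :: 'a measure) \<noteq> bot"
      by (simp add: ae_filter_eq_bot_iff emeasure_lborel_UNIV)
    ultimately obtain x :: 'a where "x \<noteq> 0" "u t x = u t' x"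
      using eventually_happens' by blast
    then show "t = t'" by (simp add: u_def)
  qed
  moreover have "infinite {t0..}" by (rule infinite_Ici)
  ultimately have "infinite ((\<lambda>t. ae_eq `` {u t}) ` {t0..})" by (simp add: finite_image_iff)
  moreover have "(\<lambda>t. ae_eq `` {u t}) ` {t0..} \<subseteq> {u. positive_classical_solution s \<mu> \<Omega> Q p u} // ae_eq"
    using sol by (auto intro!: quotientI)
  ultimately show ?thesis by (rule infinite_super[rotated])
qed

end
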